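(* Let $B=B^{r_N,1}\otimes\cdots\otimes B^{r_1,1}$ be a tensor product of KR crystals of type $C_n^{(1)}$ (with $1\le r_i\le n$, in any order), and let $u\in B$ be a ground state. Then there exist indices $i_1,\dots,i_m\in\{0,1,\dots,n\}$ such that, setting $x_0=u$ and $x_k=f_{i_k}(x_{k-1})$, each step is a Demazure arrow (i.e. $\varphi_{i_k}(x_{k-1})>0$, and if $i_k=0$ then moreover $\varepsilon_0(x_{k-1})\ge1$), and the final element $x_m$ contains no barred letter.
   Context: Crystal conventions: $\varepsilon_i(b)=\max\{k:e_i^k(b)\ne\emptyset\}$, $\varphi_i(b)=\max\{k:f_i^k(b)\ne\emptyset\}$; on tensor products $f_i(x\otimes y)=f_i(x)\otimes y$ if $\varepsilon_i(x)\ge\varphi_i(y)$, else $x\otimes f_i(y)$; $e_i(x\otimes y)=e_i(x)\otimes y$ if $\varepsilon_i(x)>\varphi_i(y)$, else $x\otimes e_i(y)$. Alphabet $1<\cdots<n<\bar n<\cdots<\bar1$. For $1\le r\le n$, $B^{r,1}$ is the set of Kashiwara--Nakashima columns of height $r$: strictly increasing $b(1)<\cdots<b(r)$ such that there is no $z\in\{1,\dots,n\}$ with $z=b(p)$, $\bar z=b(q)$ and $q-p\le r-z$. For $1\le i\le n$, $e_i,f_i$ are defined by identifying $b$ with $b(r)\otimes\cdots\otimes b(1)$ with letter operators $f_i(i)=i+1$, $f_i(\overline{i+1})=\bar i$ for $i<n$, $f_n(n)=\bar n$ ($e_i$ the inverse partial maps, other values $\emptyset$). $f_0(b)$ replaces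 $\bar1$ by $1$ and reorders if $\bar1\in b$, else $\emptyset$; $e_0(b)$ replaces $1$ by $\bar1$ if $1\in b$, else $\emptyset$. For $x$ in a crystal let $\varepsilon(x)=\sum_{i=0}^n\varepsilon_i(x)\Lambda_i$, $\varphi(x)=\sum_{i=0}^n\varphi_i(x)\Lambda_i$ (formal combinations of affine fundamental weights). An element $u=u_N\otimes\cdots\otimes u_1\in B$ ($u_k\in B^{r_k,1}$) is a ground state if $\varepsilon(u_1)=\Lambda_0$ and $\varepsilon(u_{k+1})=\varphi(u_k)$ for $1\le k\le N-1$ (equivalently, $u\otimes u_{\Lambda_0}$ is a highest weight element of $B\otimes B(\Lambda_0)$). *)

theory Defs
  imports Main "HOL-Library.Poly_Mapping"
begin

text \<open>The value \<open>None\<close> plays the role of \<open>\<emptyset>\<close>.\<close>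

record 'a crystal =
  e_op :: "nat \<Rightarrow> 'a \<Rightarrow> 'a option"
  f_op :: "nat \<Rightarrow> 'a \<Rightarrow> 'a option"

primrec iter_op :: "('a \<Rightarrow> 'a option) \<Rightarrow> nat \<Rightarrow> 'a \<Rightarrow> 'a option" where
  "iter_op g 0 x = Some x"
| "iter_op g (Suc k) x = Option.bind (iter_op g k x) g"

text \<open>In the crystals considered here every operator is nilpotent on the elements of interest,
  so the sets below are finite and contain 0.\<close>

definition eps :: "'a crystal \<Rightarrow> nat \<Rightarrow> 'a \<Rightarrow> nat" where
  "eps C i x = Max {k. iter_op (e_op C i) k x \<noteq> None}"

definition phi :: "'a crystal \<Rightarrow> nat \<Rightarrow> 'a \<Rightarrow> nat" where
  "phi C i x = Max {k. iter_op (f_op C i) k x \<noteq> None}"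

text \<open>Formal integer combinations of \<open>\<Lambda>\<^sub>0, \<Lambda>\<^sub>1, \<dots>\<close> are finitely supported functions on the indices.\<close>

type_synonym weight = "nat \<Rightarrow>\<^sub>0 int"

definition Lam :: "nat \<Rightarrow> weight" where
  "Lam i = Poly_Mapping.single i 1"

definition eps_wt :: "nat \<Rightarrow> 'a crystal \<Rightarrow> 'a \<Rightarrow> weight" where
  "eps_wt n C x = (\<Sum>i=0..n. Poly_Mapping.single i (int (eps C i x)))"

definition phi_wt :: "nat \<Rightarrow> 'a crystal \<Rightarrow> 'a \<Rightarrow> weight" where
  "phi_wt n C x = (\<Sum>i=0..n. Poly_Mapping.single i (int (phi C i x)))"

definition tensor :: "'a crystal \<Rightarrow> 'b crystal \<Rightarrow> ('a \<times> 'b) crystal" where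
  "tensor C D = \<lparr>
     e_op = (\<lambda>i (x, y). if eps C i x > phi D i y
                        then map_option (\<lambda>x'. (x', y)) (e_op C i x)
                        else map_option (\<lambda>y'. (x, y')) (e_op D i y)),
     f_op = (\<lambda>i (x, y). if eps C i x \<ge> phi D i y
                        then map_option (\<lambda>x'. (x', y)) (f_op C i x)
                        else map_option (\<lambda>y'. (x, y')) (f_op D i y)) \<rparr>"

text \<open>A tensor \<open>x\<^sub>N \<otimes> \<dots> \<otimes> x\<^sub>1\<close> is the list \<open>[x\<^sub>N, \<dots>, x\<^sub>1]\<close>: the head is the leftmost factor, and
  the product is bracketed to the right (the tensor product of crystals is associative).
  The empty tensor is the trivial crystal, on which all operators give \<open>\<emptyset>\<close>.\<close>

primrec tensor_power :: "'a crystal \<Rightarrow> nat \<Rightarrow> 'a list crystal" where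
  "tensor_power C 0 = \<lparr> e_op = (\<lambda>i xs. None), f_op = (\<lambda>i xs. None) \<rparr>"
| "tensor_power C (Suc N) = \<lparr>
     e_op = (\<lambda>i xs. map_option (\<lambda>(y, ys). y # ys)
                      (e_op (tensor C (tensor_power C N)) i (hd xs, tl xs))),
     f_op = (\<lambda>i xs. map_option (\<lambda>(y, ys). y # ys)
                      (f_op (tensor C (tensor_power C N)) i (hd xs, tl xs))) \<rparr>"

definition tensor_list :: "'a crystal \<Rightarrow> 'a list crystal" where
  "tensor_list C = \<lparr>
     e_op = (\<lambda>i xs. e_op (tensor_power C (length xs)) i xs),
     f_op = (\<lambda>i xs. f_op (tensor_power C (length xs)) i xs) \<rparr>"

datatype letter = Unbarred nat | Barred nat

definition alphabet :: "nat \<Rightarrow> letter set" where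
  "alphabet n = Unbarred ` {1..n} \<union> Barred ` {1..n}"

instantiation letter :: linorder
begin

fun less_letter :: "letter \<Rightarrow> letter \<Rightarrow> bool" where
  "less_letter (Unbarred i) (Unbarred j) \<longleftrightarrow> i < j"
| "less_letter (Unbarred i) (Barred j) \<longleftrightarrow> True"
| "less_letter (Barred i) (Unbarred j) \<longleftrightarrow> False"
| "less_letter (Barred i) (Barred j) \<longleftrightarrow> j < i"

definition less_eq_letter :: "letter \<Rightarrow> letter \<Rightarrow> bool" where
  "less_eq_letter x y \<longleftrightarrow> x < y \<or> x = y"

instance
proof
  fix x y z :: letter
  show "(x < y) = (x \<le> y \<and> \<not> y \<le> x)"
    by (cases x; cases y) (auto simp: less_eq_letter_def)
  show "x \<le> x"
    by (simp add: less_eq_letter_def)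
  show "x \<le> y \<Longrightarrow> y \<le> z \<Longrightarrow> x \<le> z"
    by (cases x; cases y; cases z) (auto simp: less_eq_letter_def)
  show "x \<le> y \<Longrightarrow> y \<le> x \<Longrightarrow> x = y"
    by (cases x; cases y) (auto simp: less_eq_letter_def)
  show "x \<le> y \<or> y \<le> x"
    by (cases x; cases y) (auto simp: less_eq_letter_def)
qed

end

text \<open>The crystal of the vector representation, for the classical indices \<open>1 \<le> i \<le> n\<close>.\<close>

fun letter_f :: "nat \<Rightarrow> nat \<Rightarrow> letter \<Rightarrow> letter option" where
  "letter_f n i (Unbarred j) =
     (if i < n \<and> j = i then Some (Unbarred (i + 1))
      else if i = n \<and> j = n then Some (Barred n) else None)"
| "letter_f n i (Barred j) =
     (if i < n \<and> j = i + 1 then Some (Barred i) else None)"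

fun letter_e :: "nat \<Rightarrow> nat \<Rightarrow> letter \<Rightarrow> letter option" where
  "letter_e n i (Unbarred j) =
     (if i < n \<and> j = i + 1 then Some (Unbarred i) else None)"
| "letter_e n i (Barred j) =
     (if i < n \<and> j = i then Some (Barred (i + 1))
      else if i = n \<and> j = n then Some (Unbarred n) else None)"

definition letter_crystal :: "nat \<Rightarrow> letter crystal" where
  "letter_crystal n = \<lparr> e_op = letter_e n, f_op = letter_f n \<rparr>"

text \<open>A column \<open>b(1) < \<dots> < b(r)\<close> is the list \<open>[b(1), \<dots>, b(r)]\<close>. Positions \<open>p, q\<close> are 1-based,
  and the subtractions in the admissibility condition are over the integers.\<close>

type_synonym column = "letter list"

definition KN_columns :: "nat \<Rightarrow> nat \<Rightarrow> column set" where
  "KN_columns n r = {b. length b = r \<and> set b \<subseteq> alphabet n \<and> sorted_wrt (<) b \<and>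
     \<not> (\<exists>z\<in>{1..n}. \<exists>p\<in>{1..r}. \<exists>q\<in>{1..r}.
          b ! (p - 1) = Unbarred z \<and> b ! (q - 1) = Barred z \<and> int q - int p \<le> int r - int z)}"

definition replace_letter :: "letter \<Rightarrow> letter \<Rightarrow> column \<Rightarrow> column option" where
  "replace_letter x y b =
     (if x \<in> set b then Some (sort (map (\<lambda>l. if l = x then y else l) b)) else None)"

text \<open>For \<open>i \<noteq> 0\<close> the column \<open>b\<close> is identified with \<open>b(r) \<otimes> \<dots> \<otimes> b(1)\<close>, that is, with the reversed
  list. The operators do not depend on the height of the column.\<close>

definition column_crystal :: "nat \<Rightarrow> column crystal" where
  "column_crystal n = \<lparr>
     e_op = (\<lambda>i b. if i = 0 then replace_letter (Unbarred 1) (Barred 1) b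
                   else map_option rev (e_op (tensor_list (letter_crystal n)) i (rev b))),
     f_op = (\<lambda>i b. if i = 0 then replace_letter (Barred 1) (Unbarred 1) b
                   else map_option rev (f_op (tensor_list (letter_crystal n)) i (rev b))) \<rparr>"

abbreviation KR_tensor_crystal :: "nat \<Rightarrow> column list crystal" where
  "KR_tensor_crystal n \<equiv> tensor_list (column_crystal n)"

text \<open>\<open>factor u k\<close> is the factor \<open>u\<^sub>k\<close> of \<open>u = u\<^sub>N \<otimes> \<dots> \<otimes> u\<^sub>1\<close>, for \<open>1 \<le> k \<le> N\<close>.\<close>

definition factor :: "column list \<Rightarrow> nat \<Rightarrow> column" where
  "factor u k = rev u ! (k - 1)"

text \<open>The underlying set of \<open>B\<^bsup>r N,1\<^esup> \<otimes> \<dots> \<otimes> B\<^bsup>r 1,1\<^esup>\<close>.\<close>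

definition KR_tensor :: "nat \<Rightarrow> nat \<Rightarrow> (nat \<Rightarrow> nat) \<Rightarrow> column list set" where
  "KR_tensor n N r = {u. length u = N \<and> (\<forall>k\<in>{1..N}. factor u k \<in> KN_columns n (r k))}"

definition ground_state :: "nat \<Rightarrow> column list \<Rightarrow> bool" where
  "ground_state n u \<longleftrightarrow>
     u \<noteq> [] \<and>
     eps_wt n (column_crystal n) (factor u 1) = Lam 0 \<and>
     (\<forall>k\<in>{1..length u - 1}.
        eps_wt n (column_crystal n) (factor u (k + 1)) =
        phi_wt n (column_crystal n) (factor u k))"

definition demazure_arrow :: "'a crystal \<Rightarrow> nat \<Rightarrow> 'a \<Rightarrow> 'a \<Rightarrow> bool" where
  "demazure_arrow C i x y \<longleftrightarrow>
     f_op C i x = Some y \<and> phi C i x > 0 \<and> (i = 0 \<longrightarrow> eps C 0 x \<ge> 1)"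

definition no_barred_letter :: "column list \<Rightarrow> bool" where
  "no_barred_letter u \<longleftrightarrow> (\<forall>b\<in>set u. \<forall>z. Barred z \<notin> set b)"

end

theory Submission
  imports Defs
begin

text \<open>A column with \<open>\<epsilon> = \<Lambda>\<^sub>a\<close> consists of the letters \<open>a+1, \<dots>, c\<close> and the bars of \<open>d+1, \<dots>, c\<close>, with
  \<open>\<phi> = \<Lambda>\<^sub>d\<close> and \<open>c - d \<le> a \<le> c\<close>, the inequality \<open>c - d \<le> a\<close> being the Kashiwara--Nakashima condition.
  Call one turn the application of the maximal strings of \<open>f\<^sub>n, f\<^sub>n\<^sub>-\<^sub>1, \<dots>, f\<^sub>0\<close>, in this order. A turn
  shifts a column without bars cyclically (\<open>i\<close> becomes \<open>i + 1\<close>, and \<open>n\<close> becomes \<open>1\<close>), and it carries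
  the lowest bar of the column above (the bar of \<open>d+1\<close>) down to a new letter \<open>1\<close>, so that \<open>c - d\<close> turns
  remove all bars.

  Let \<open>b \<otimes> u\<close> be a ground state, where \<open>\<phi>(u) = \<Lambda>\<^sub>a\<close>. The first \<open>c - d\<close> turns act on \<open>b\<close> alone and
  leave \<open>b' \<otimes> u\<close> with \<open>b'\<close> free of bars. Then the turns that clear \<open>u\<close>, which exist by induction, lift
  to the tensor product, because at each string \<open>\<epsilon>\<^sub>i\<close> vanishes on the left factor: that string is then
  followed to its end on both factors at once, and the left factor is merely shifted.\<close>

section \<open>Normal crystals and their tensor products\<close>

text \<open>For an operator \<open>f\<^sub>i\<close> the pair \<open>m\<close>, \<open>m'\<close> is
  meant to be \<phi>, \<epsilon>, and for \<open>e\<^sub>i\<close> the reverse. Posing this as local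
  conditions allows string lengths to be identified from guessed formulas, without computing a
  maximum over iterates each time.\<close>

definition graded_by :: "('a \<Rightarrow> 'a option) \<Rightarrow> 'a set \<Rightarrow> ('a \<Rightarrow> nat) \<Rightarrow> ('a \<Rightarrow> nat) \<Rightarrow> bool" where
  "graded_by g A m m' \<longleftrightarrow> (\<forall>x\<in>A. case g x of None \<Rightarrow> m x = 0
     | Some y \<Rightarrow> y \<in> A \<and> m x = Suc (m y) \<and> m' y = Suc (m' x))"

lemma graded_by_None: "graded_by g A m m' \<Longrightarrow> x \<in> A \<Longrightarrow> g x = None \<longleftrightarrow> m x = 0"
  by (force simp: graded_by_def split: option.splits)

lemma graded_by_Some:
  "graded_by g A m m' \<Longrightarrow> x \<in> A \<Longrightarrow> g x = Some y \<Longrightarrow>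
     y \<in> A \<and> m x = Suc (m y) \<and> m' y = Suc (m' x)"
  by (force simp: graded_by_def split: option.splits)

lemma graded_byI:
  assumes "\<And>x. x \<in> A \<Longrightarrow> g x = None \<Longrightarrow> m x = 0"
    and "\<And>x y. x \<in> A \<Longrightarrow> g x = Some y \<Longrightarrow> y \<in> A \<and> m x = Suc (m y) \<and> m' y = Suc (m' x)"
  shows "graded_by g A m m'"
  using assms by (auto simp: graded_by_def split: option.splits)

lemma graded_by_cong:
  assumes "graded_by g A m m'" and "\<And>x. x \<in> A \<Longrightarrow> m x = l x" and "\<And>x. x \<in> A \<Longrightarrow> m' x = l' x"
  shows "graded_by g A l l'"
  using assms by (auto simp: graded_by_def split: option.splits)

lemma iter_op_graded:
  assumes "graded_by g A m m'" and "x \<in> A" and "k \<le> m x"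
  shows "\<exists>y\<in>A. iter_op g k x = Some y \<and> m y + k = m x \<and> m' y = m' x + k"
  using assms(3)
proof (induction k)
  case 0
  then show ?case using assms(2) by simp
next
  case (Suc k)
  then obtain y where y: "y \<in> A" "iter_op g k x = Some y" "m y + k = m x" "m' y = m' x + k"
    by auto
  with Suc.prems have "g y \<noteq> None"
    using graded_by_None[OF assms(1) y(1)] by simp
  then obtain z where z: "g y = Some z" by auto
  from graded_by_Some[OF assms(1) y(1) z] show ?case
    using y z by auto
qed

text \<open>\<open>m\<close> drops by one per step and \<open>g\<close> stops exactly where
  \<open>m\<close> is 0, so the defined iterates are those with \<open>k \<le> m x\<close>. This
  evaluates the maxima in \<open>eps\<close> and \<open>phi\<close>.\<close>

lemma iter_op_graded_max:
  assumes "graded_by g A m m'" and "x \<in> A"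
  shows "Max {k. iter_op g k x \<noteq> None} = m x"
proof -
  have None: "iter_op g (Suc (m x) + k) x = None" for k
  proof (induction k)
    case 0
    obtain y where "y \<in> A" "iter_op g (m x) x = Some y" "m y = 0"
      using iter_op_graded[OF assms, of "m x"] by auto
    then show ?case using graded_by_None[OF assms(1)] by auto
  qed simp
  have "iter_op g k x \<noteq> None \<longleftrightarrow> k \<le> m x" for k
  proof
    show "k \<le> m x" if "iter_op g k x \<noteq> None"
      using None[of "k - Suc (m x)"] that by (cases "k \<le> m x") auto
    show "iter_op g k x \<noteq> None" if "k \<le> m x"
      using iter_op_graded[OF assms that] by auto
  qed
  then have "{k. iter_op g k x \<noteq> None} = {..m x}" by auto
  then show ?thesis by (simp add: Max_eq_iff)
qed

definition normal :: "'a crystal \<Rightarrow> nat \<Rightarrow> 'a set \<Rightarrow> bool" where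
  "normal C i A \<longleftrightarrow> graded_by (e_op C i) A (eps C i) (phi C i) \<and>
     graded_by (f_op C i) A (phi C i) (eps C i)"

text \<open>The way \<epsilon> and \<phi> are computed throughout: functions that satisfy the local
  conditions for both operators have to be the string lengths.\<close>

lemma normal_gradings:
  assumes "graded_by (e_op C i) A E F" and "graded_by (f_op C i) A F E"
  shows "normal C i A" and "x \<in> A \<Longrightarrow> eps C i x = E x" and "x \<in> A \<Longrightarrow> phi C i x = F x"
proof -
  have *: "eps C i x = E x" "phi C i x = F x" if "x \<in> A" for x
    using iter_op_graded_max[OF assms(1) that] iter_op_graded_max[OF assms(2) that]
    by (simp_all add: eps_def phi_def)
  then show "x \<in> A \<Longrightarrow> eps C i x = E x" "x \<in> A \<Longrightarrow> phi C i x = F x" by blast+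
  show "normal C i A"
    unfolding normal_def
    using graded_by_cong[OF assms(1)] graded_by_cong[OF assms(2)] * by metis
qed

section \<open>Tensor products of finitely many factors\<close>

lemma tensor_power_length:
  "e_op (tensor_power C N) i xs = Some ys \<Longrightarrow> length xs = N \<Longrightarrow> length ys = N"
  "f_op (tensor_power C N) i xs = Some ys \<Longrightarrow> length xs = N \<Longrightarrow> length ys = N"
proof (induction N arbitrary: xs ys)
  case (Suc N)
  {
    case 1
    then show ?case using Suc.IH(1)[of "tl xs"]
      by (auto simp: tensor_def split: if_splits)
  next
    case 2
    then show ?case using Suc.IH(2)[of "tl xs"]
      by (auto simp: tensor_def split: if_splits)
  }
qed simp_all

text \<open>The operators preserve length, so iterating \<open>tensor_list\<close>, which selects
  the tensor power by the length, never leaves one tensor power. Hence the tensor rule can be stated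
  with \<open>tensor_list\<close> alone.\<close>

lemma phi_tensor_list: "phi (tensor_list C) i xs = phi (tensor_power C (length xs)) i xs"
proof -
  have "iter_op (f_op (tensor_list C) i) k xs = iter_op (f_op (tensor_power C (length xs)) i) k xs \<and>
      (\<forall>ys. iter_op (f_op (tensor_power C (length xs)) i) k xs = Some ys \<longrightarrow> length ys = length xs)"
    for k
  proof (induction k)
    case (Suc k)
    then show ?case
      by (cases "iter_op (f_op (tensor_power C (length xs)) i) k xs")
        (auto simp: tensor_list_def intro: tensor_power_length(2))
  qed simp
  then show ?thesis by (simp add: phi_def)
qed

lemma tensor_list_Nil: "e_op (tensor_list C) i [] = None" "f_op (tensor_list C) i [] = None"
  by (simp_all add: tensor_list_def)

lemma tensor_list_Cons:
  "e_op (tensor_list C) i (x # xs) =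
     (if eps C i x > phi (tensor_list C) i xs then map_option (\<lambda>y. y # xs) (e_op C i x)
      else map_option ((#) x) (e_op (tensor_list C) i xs))"
  "f_op (tensor_list C) i (x # xs) =
     (if eps C i x \<ge> phi (tensor_list C) i xs then map_option (\<lambda>y. y # xs) (f_op C i x)
      else map_option ((#) x) (f_op (tensor_list C) i xs))"
  unfolding phi_tensor_list
  by (auto simp: tensor_list_def tensor_def option.map_comp comp_def)

text \<open>The standard formulas \<open>\<epsilon>(x \<otimes> y) = \<epsilon>(y) + max 0
  (\<epsilon>(x) - \<phi>(y))\<close> and \<open>\<phi>(x \<otimes> y) = \<phi>(x) + max 0
  (\<phi>(y) - \<epsilon>(x))\<close>; truncated subtraction is the positive part.\<close>

fun list_eps :: "'a crystal \<Rightarrow> nat \<Rightarrow> 'a list \<Rightarrow> nat"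
  and list_phi :: "'a crystal \<Rightarrow> nat \<Rightarrow> 'a list \<Rightarrow> nat" where
  "list_eps C i [] = 0"
| "list_eps C i (x # xs) = list_eps C i xs + (eps C i x - list_phi C i xs)"
| "list_phi C i [] = 0"
| "list_phi C i (x # xs) = phi C i x + (list_phi C i xs - eps C i x)"

text \<open>Induction on the number of factors: the hypothesis identifies \<phi> of the tail with
  \<open>list_phi\<close>, which is the quantity that the tensor rule compares with \<epsilon> of
  the head.\<close>

lemma normal_tensor_list_length:
  assumes "normal C i A"
  shows "graded_by (e_op (tensor_list C) i) {xs \<in> lists A. length xs = N} (list_eps C i) (list_phi C i) \<and>
     graded_by (f_op (tensor_list C) i) {xs \<in> lists A. length xs = N} (list_phi C i) (list_eps C i)"
proof (induction N)
  case 0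
  then show ?case by (auto simp: graded_by_def tensor_list_Nil)
next
  case (Suc N)
  let ?B = "{xs \<in> lists A. length xs = N}"
  note IH = Suc.IH[THEN conjunct1] Suc.IH[THEN conjunct2]
  note n = assms[unfolded normal_def, THEN conjunct1] assms[unfolded normal_def, THEN conjunct2]
  have phi: "phi (tensor_list C) i xs = list_phi C i xs" if "xs \<in> ?B" for xs
    using normal_gradings(3)[OF IH that] .
  have "graded_by (e_op (tensor_list C) i) {xs \<in> lists A. length xs = Suc N} (list_eps C i) (list_phi C i)"
  proof (rule graded_byI)
    fix zs assume "zs \<in> {xs \<in> lists A. length xs = Suc N}" and None: "e_op (tensor_list C) i zs = None"
    then obtain x xs where zs: "zs = x # xs" and x: "x \<in> A" and xs: "xs \<in> ?B" by (cases zs) auto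
    show "list_eps C i zs = 0"
      using None graded_by_None[OF n(1) x] graded_by_None[OF IH(1) xs]
      by (simp add: zs tensor_list_Cons phi[OF xs] split: if_splits)
  next
    fix zs ys assume "zs \<in> {xs \<in> lists A. length xs = Suc N}" and Some: "e_op (tensor_list C) i zs = Some ys"
    then obtain x xs where zs: "zs = x # xs" and x: "x \<in> A" and xs: "xs \<in> ?B" by (cases zs) auto
    have len: "xs \<in> lists A" "length xs = N" using xs by simp_all
    show "ys \<in> {xs \<in> lists A. length xs = Suc N} \<and>
        list_eps C i zs = Suc (list_eps C i ys) \<and> list_phi C i ys = Suc (list_phi C i zs)"
    \<comment> \<open>By strictness the head still has \<epsilon> at least \<phi> of the tail after
      the step, so one positive part drops by exactly one and the other stays 0.\<close>
    proof (cases "eps C i x > list_phi C i xs")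
      case True
      with Some obtain y where y: "e_op C i x = Some y" "ys = y # xs"
        by (auto simp: zs tensor_list_Cons phi[OF xs])
      with True graded_by_Some[OF n(1) x y(1)] len show ?thesis by (simp add: zs)
    next
      case False
      with Some obtain y where y: "e_op (tensor_list C) i xs = Some y" "ys = x # y"
        by (auto simp: zs tensor_list_Cons phi[OF xs])
      with False graded_by_Some[OF IH(1) xs y(1)] x show ?thesis by (simp add: zs)
    qed
  qed
  moreover
  have "graded_by (f_op (tensor_list C) i) {xs \<in> lists A. length xs = Suc N} (list_phi C i) (list_eps C i)"
  proof (rule graded_byI)
    fix zs assume "zs \<in> {xs \<in> lists A. length xs = Suc N}" and None: "f_op (tensor_list C) i zs = None"
    then obtain x xs where zs: "zs = x # xs" and x: "x \<in> A" and xs: "xs \<in> ?B" by (cases zs) auto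
    show "list_phi C i zs = 0"
      using None graded_by_None[OF n(2) x] graded_by_None[OF IH(2) xs]
      by (simp add: zs tensor_list_Cons phi[OF xs] split: if_splits)
  next
    fix zs ys assume "zs \<in> {xs \<in> lists A. length xs = Suc N}" and Some: "f_op (tensor_list C) i zs = Some ys"
    then obtain x xs where zs: "zs = x # xs" and x: "x \<in> A" and xs: "xs \<in> ?B" by (cases zs) auto
    have len: "xs \<in> lists A" "length xs = N" using xs by simp_all
    show "ys \<in> {xs \<in> lists A. length xs = Suc N} \<and>
        list_phi C i zs = Suc (list_phi C i ys) \<and> list_eps C i ys = Suc (list_eps C i zs)"
    proof (cases "eps C i x \<ge> list_phi C i xs")
      case True
      with Some obtain y where y: "f_op C i x = Some y" "ys = y # xs"
        by (auto simp: zs tensor_list_Cons phi[OF xs])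
      with True graded_by_Some[OF n(2) x y(1)] len show ?thesis by (simp add: zs)
    next
      case False
      with Some obtain y where y: "f_op (tensor_list C) i xs = Some y" "ys = x # y"
        by (auto simp: zs tensor_list_Cons phi[OF xs])
      with False graded_by_Some[OF IH(2) xs y(1)] x show ?thesis by (simp add: zs)
    qed
  qed
  ultimately show ?case by blast
qed

lemma normal_tensor_list:
  assumes "normal C i A"
  shows "normal (tensor_list C) i (lists A)"
    and "xs \<in> lists A \<Longrightarrow> eps (tensor_list C) i xs = list_eps C i xs"
    and "xs \<in> lists A \<Longrightarrow> phi (tensor_list C) i xs = list_phi C i xs"
proof -
  have union: "graded_by g (lists A) m m'"
    if graded: "\<And>N. graded_by g {xs \<in> lists A. length xs = N} m m'" for g and m m' :: "'a list \<Rightarrow> nat"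
  proof (rule graded_byI)
    fix xs assume xs: "xs \<in> lists A"
    then have *: "xs \<in> {ys \<in> lists A. length ys = length xs}" by simp
    show "m xs = 0" if "g xs = None"
      using graded_by_None[OF graded *] that by simp
    show "ys \<in> lists A \<and> m xs = Suc (m ys) \<and> m' ys = Suc (m' xs)" if "g xs = Some ys" for ys
      using graded_by_Some[OF graded * that] by simp
  qed
  have *: "graded_by (e_op (tensor_list C) i) (lists A) (list_eps C i) (list_phi C i)"
    "graded_by (f_op (tensor_list C) i) (lists A) (list_phi C i) (list_eps C i)"
    using normal_tensor_list_length[OF assms] by (auto intro: union)
  note normal_gradings[OF *]
  then show "normal (tensor_list C) i (lists A)"
    "xs \<in> lists A \<Longrightarrow> eps (tensor_list C) i xs = list_eps C i xs"
    "xs \<in> lists A \<Longrightarrow> phi (tensor_list C) i xs = list_phi C i xs" by blast+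
qed

lemma normal_tensor_list_Cons:
  assumes "normal C i A" and "x \<in> A" and "xs \<in> lists A"
  shows "eps (tensor_list C) i (x # xs) =
      eps (tensor_list C) i xs + (eps C i x - phi (tensor_list C) i xs)"
    and "phi (tensor_list C) i (x # xs) =
      phi C i x + (phi (tensor_list C) i xs - eps C i x)"
  using assms normal_tensor_list(2,3)[OF assms(1)] by simp_all

section \<open>Full strings\<close>

text \<open>Each step lowers \<phi> of the tail by one; the bound keeps it strictly above \<epsilon>
  of the head before every step, so the rule keeps choosing the tail.\<close>

lemma iter_op_Cons_right:
  assumes "normal C i A" and "x \<in> A" and "xs \<in> lists A"
    and "eps C i x + k \<le> phi (tensor_list C) i xs"
  shows "iter_op (f_op (tensor_list C) i) k (x # xs) =
    map_option ((#) x) (iter_op (f_op (tensor_list C) i) k xs)"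
  using assms(4)
proof (induction k)
  case (Suc k)
  have "graded_by (f_op (tensor_list C) i) (lists A) (phi (tensor_list C) i) (eps (tensor_list C) i)"
    using normal_tensor_list(1)[OF assms(1)] by (simp add: normal_def)
  from iter_op_graded[OF this assms(3), of k] Suc.prems
  obtain ys where "iter_op (f_op (tensor_list C) i) k xs = Some ys"
    "phi (tensor_list C) i ys + k = phi (tensor_list C) i xs"
    by auto
  with Suc show ?case by (simp add: tensor_list_Cons)
qed simp

text \<open>Once the rule chooses the head, \<open>f\<^sub>i\<close> only raises \<epsilon> of the
  head, so the choice never changes back.\<close>

lemma iter_op_Cons_left:
  assumes "normal C i A" and "x \<in> A" and "phi (tensor_list C) i xs \<le> eps C i x" and "k \<le> phi C i x"
  shows "iter_op (f_op (tensor_list C) i) k (x # xs) =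
    map_option (\<lambda>y. y # xs) (iter_op (f_op C i) k x)"
  using assms(4)
proof (induction k)
  case (Suc k)
  have "graded_by (f_op C i) A (phi C i) (eps C i)"
    using assms(1) by (simp add: normal_def)
  from iter_op_graded[OF this assms(2), of k] Suc.prems
  obtain y where "iter_op (f_op C i) k x = Some y" "eps C i y = eps C i x + k"
    by auto
  with Suc assms(3) show ?case by (simp add: tensor_list_Cons)
qed simp

lemma iter_op_add: "iter_op g (j + k) x = Option.bind (iter_op g j x) (iter_op g k)"
  by (induction k) (cases "iter_op g j x"; simp)+

text \<open>With \<open>E i = of_bool (i = 0)\<close> every arrow of a full string is a Demazure arrow. On the left factor
  of \<open>x \<otimes> u\<close>, with \<open>u\<close> fixed, the start of such a string corresponds to \<open>E i = \<phi>\<^sub>i(u)\<close>.\<close>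

definition full_string :: "'a crystal \<Rightarrow> (nat \<Rightarrow> 'a set) \<Rightarrow> (nat \<Rightarrow> nat) \<Rightarrow> nat \<Rightarrow> 'a \<Rightarrow> 'a \<Rightarrow> bool" where
  "full_string C A E i x y \<longleftrightarrow>
     x \<in> A i \<and> eps C i x = E i \<and> iter_op (f_op C i) (phi C i x) x = Some y"

primrec full_strings ::
  "'a crystal \<Rightarrow> (nat \<Rightarrow> 'a set) \<Rightarrow> (nat \<Rightarrow> nat) \<Rightarrow> nat list \<Rightarrow> 'a \<Rightarrow> 'a \<Rightarrow> bool" where
  "full_strings C A E [] x z \<longleftrightarrow> x = z"
| "full_strings C A E (i # is) x z \<longleftrightarrow>
     (\<exists>y. full_string C A E i x y \<and> full_strings C A E is y z)"

lemma full_strings_append: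
  "full_strings C A E (is @ js) x z \<longleftrightarrow>
     (\<exists>y. full_strings C A E is x y \<and> full_strings C A E js y z)"
  by (induction "is" arbitrary: x) auto

text \<open>\<open>X (Suc i)\<close> is the state just before index \<open>i\<close> acts and
  \<open>X i\<close> the state just after, the indices running down from \<open>k - 1\<close> to
  0.\<close>

lemma full_strings_downto:
  assumes "\<And>i. i < k \<Longrightarrow> full_string C A E i (X (Suc i)) (X i)"
  shows "full_strings C A E (rev [0..<k]) (X k) (X 0)"
  using assms by (induction k) auto

lemma full_strings_power:
  assumes "\<And>h. h < m \<Longrightarrow> full_strings C A E is (X h) (X (Suc h))"
  shows "full_strings C A E (concat (replicate m is)) (X 0) (X m)"
  using assms
proof (induction m)
  case (Suc m)
  have eq: "replicate (Suc m) is = replicate m is @ [is]"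
    by (simp add: replicate_append_same)
  have "full_strings C A E (concat (replicate m is)) (X 0) (X m)"
    "full_strings C A E is (X m) (X (Suc m))"
    using Suc by simp_all
  then show ?case
    unfolding eq by (simp add: full_strings_append) blast
qed simp

text \<open>Since \<epsilon> vanishes on the head, the string first exhausts the tail, whose \<phi>
  is then 0, and afterwards exhausts the head. The product has the \<epsilon> of the tail, so
  \<open>E\<close> is inherited from it.\<close>

lemma full_strings_Cons:
  assumes "\<And>i. i \<in> set is \<Longrightarrow> normal C i (A i)"
    and "full_strings C A (\<lambda>_. 0) is x x'"
    and "full_strings (tensor_list C) (\<lambda>i. lists (A i)) E is ys ys'"
  shows "full_strings (tensor_list C) (\<lambda>i. lists (A i)) E is (x # ys) (x' # ys')"
  using assms
proof (induction "is" arbitrary: x ys)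
  case (Cons i "is")
  let ?T = "tensor_list C"
  from Cons.prems obtain w ws
    where w: "x \<in> A i" "eps C i x = 0" "iter_op (f_op C i) (phi C i x) x = Some w"
      "full_strings C A (\<lambda>_. 0) is w x'"
    and ws: "ys \<in> lists (A i)" "eps ?T i ys = E i" "iter_op (f_op ?T i) (phi ?T i ys) ys = Some ws"
      "full_strings ?T (\<lambda>i. lists (A i)) E is ws ys'"
    by (auto simp: full_string_def)
  have n: "normal C i (A i)" using Cons.prems(1) by simp
  have "graded_by (f_op ?T i) (lists (A i)) (phi ?T i) (eps ?T i)"
    using normal_tensor_list(1)[OF n] by (simp add: normal_def)
  from iter_op_graded[OF this ws(1), of "phi ?T i ys"] ws(3)
  have ws0: "phi ?T i ws = 0" by simp
  have phi: "phi ?T i (x # ys) = phi ?T i ys + phi C i x"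
    and eps: "eps ?T i (x # ys) = E i"
    using normal_tensor_list_Cons[OF n w(1) ws(1)] w(2) ws(2) by simp_all
  have "iter_op (f_op ?T i) (phi ?T i (x # ys)) (x # ys) = Some (w # ws)"
    unfolding phi iter_op_add
    using iter_op_Cons_right[OF n w(1) ws(1), of "phi ?T i ys"]
      iter_op_Cons_left[OF n w(1), of ws "phi C i x"] w ws ws0 by simp
  then have "full_string ?T (\<lambda>i. lists (A i)) E i (x # ys) (w # ws)"
    using w(1) ws(1) eps by (simp add: full_string_def)
  moreover have "full_strings ?T (\<lambda>i. lists (A i)) E is (w # ws) (x' # ys')"
    using Cons.IH[OF _ w(4) ws(4)] Cons.prems(1) by simp
  ultimately show ?case by auto
qed simp

text \<open>\<open>D\<close> is both \<phi> of the fixed tail and \<epsilon> of the head at the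
  start of each string. The two cancel: the tail never moves, and the product has \<phi> of the head
  and \<epsilon> of the tail.\<close>

lemma full_strings_Cons_left:
  assumes "\<And>i. i \<in> set is \<Longrightarrow> normal C i (A i)"
    and "full_strings C A D is x x'"
    and "\<And>i. i \<in> set is \<Longrightarrow> ys \<in> lists (A i)"
    and "\<And>i. i \<in> set is \<Longrightarrow> eps (tensor_list C) i ys = E i"
    and "\<And>i. i \<in> set is \<Longrightarrow> phi (tensor_list C) i ys = D i"
  shows "full_strings (tensor_list C) (\<lambda>i. lists (A i)) E is (x # ys) (x' # ys)"
  using assms
proof (induction "is" arbitrary: x)
  case (Cons i "is")
  let ?T = "tensor_list C"
  from Cons.prems obtain w
    where w: "x \<in> A i" "eps C i x = D i" "iter_op (f_op C i) (phi C i x) x = Some w"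
      "full_strings C A D is w x'"
    by (auto simp: full_string_def)
  have n: "normal C i (A i)" and ys: "ys \<in> lists (A i)"
    and e: "eps ?T i ys = E i" "phi ?T i ys = D i" using Cons.prems by simp_all
  have "iter_op (f_op ?T i) (phi ?T i (x # ys)) (x # ys) = Some (w # ys)"
    using normal_tensor_list_Cons[OF n w(1) ys] iter_op_Cons_left[OF n w(1), of ys "phi C i x"]
    by (simp add: w e)
  then have "full_string ?T (\<lambda>i. lists (A i)) E i (x # ys) (w # ys)"
    using w(1,2) ys e normal_tensor_list_Cons[OF n w(1) ys] by (simp add: full_string_def)
  moreover have "full_strings ?T (\<lambda>i. lists (A i)) E is (w # ys) (x' # ys)"
    using Cons.IH[OF _ w(4)] Cons.prems by simp
  ultimately show ?case by auto
qed simp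

section \<open>From full strings to Demazure arrows\<close>

definition demazure_step :: "'a crystal \<Rightarrow> nat \<Rightarrow> 'a \<Rightarrow> 'a \<Rightarrow> bool" where
  "demazure_step C n x y \<longleftrightarrow> (\<exists>i\<in>{0..n}. demazure_arrow C i x y)"

text \<open>Along the string \<epsilon> only grows. A 0-string starts with
  \<open>\<epsilon>\<^sub>0 = 1\<close>, so each of its arrows is a Demazure arrow; for the other
  indices positivity of \<phi> is the whole condition.\<close>

lemma full_string_demazure:
  assumes "normal C i (A i)" and "i \<le> n" and "full_string C A (\<lambda>i. of_bool (i = 0)) i x y"
  shows "(demazure_step C n)\<^sup>*\<^sup>* x y"
proof -
  from assms(3) have x: "x \<in> A i" "eps C i x = of_bool (i = 0)"
    and y: "iter_op (f_op C i) (phi C i x) x = Some y"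
    by (auto simp: full_string_def)
  have g: "graded_by (f_op C i) (A i) (phi C i) (eps C i)"
    using assms(1) by (simp add: normal_def)
  have "\<exists>z. iter_op (f_op C i) k x = Some z \<and> (demazure_step C n)\<^sup>*\<^sup>* x z" if "k \<le> phi C i x" for k
    using that
  proof (induction k)
    case (Suc k)
    then obtain z where z: "iter_op (f_op C i) k x = Some z" "(demazure_step C n)\<^sup>*\<^sup>* x z"
      by auto
    have z': "phi C i z + k = phi C i x" "eps C i z = eps C i x + k" "z \<in> A i"
      using iter_op_graded[OF g x(1), of k] Suc.prems z(1) by auto
    with Suc.prems obtain w where w: "f_op C i z = Some w"
      using graded_by_None[OF g z'(3)] by fastforce
    have "demazure_step C n z w"
      using w z' x(2) Suc.prems assms(2) by (auto simp: demazure_step_def demazure_arrow_def)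
    with z w show ?case by (auto intro: rtranclp.rtrancl_into_rtrancl)
  qed simp
  from this[of "phi C i x"] y show ?thesis by auto
qed

lemma full_strings_demazure:
  assumes "\<And>i. i \<le> n \<Longrightarrow> normal C i (A i)" and "set is \<subseteq> {0..n}"
    and "full_strings C A (\<lambda>i. of_bool (i = 0)) is x y"
  shows "(demazure_step C n)\<^sup>*\<^sup>* x y"
  using assms(2,3)
proof (induction "is" arbitrary: x)
  case (Cons i "is")
  then obtain w where w: "full_string C A (\<lambda>i. of_bool (i = 0)) i x w"
      "full_strings C A (\<lambda>i. of_bool (i = 0)) is w y" and i: "i \<le> n" and "set is \<subseteq> {0..n}"
    by auto
  have "(demazure_step C n)\<^sup>*\<^sup>* x w"
    using full_string_demazure[OF assms(1)[OF i] i w(1)] .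
  also have "(demazure_step C n)\<^sup>*\<^sup>* w y"
    using Cons.IH w(2) \<open>set is \<subseteq> {0..n}\<close> by blast
  finally show ?case .
qed simp

section \<open>The operators on a single column\<close>

text \<open>Every string in the vector representation has at most one arrow, so \<epsilon> and
  \<phi> just record whether the operator is defined.\<close>

lemma normal_letter:
  assumes "1 \<le> i"
  shows "normal (letter_crystal n) i UNIV"
    and "eps (letter_crystal n) i l = of_bool (letter_e n i l \<noteq> None)"
    and "phi (letter_crystal n) i l = of_bool (letter_f n i l \<noteq> None)"
proof -
  have "graded_by (e_op (letter_crystal n) i) UNIV
      (\<lambda>l. of_bool (letter_e n i l \<noteq> None)) (\<lambda>l. of_bool (letter_f n i l \<noteq> None))"
  proof (rule graded_byI)
    fix x y assume "e_op (letter_crystal n) i x = Some y"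
    with assms show "y \<in> UNIV \<and> (of_bool (letter_e n i x \<noteq> None) :: nat) = Suc (of_bool (letter_e n i y \<noteq> None)) \<and>
        (of_bool (letter_f n i y \<noteq> None) :: nat) = Suc (of_bool (letter_f n i x \<noteq> None))"
      by (cases x) (auto simp: letter_crystal_def split: if_splits)
  qed (simp add: letter_crystal_def)
  moreover have "graded_by (f_op (letter_crystal n) i) UNIV
      (\<lambda>l. of_bool (letter_f n i l \<noteq> None)) (\<lambda>l. of_bool (letter_e n i l \<noteq> None))"
  proof (rule graded_byI)
    fix x y assume "f_op (letter_crystal n) i x = Some y"
    with assms show "y \<in> UNIV \<and> (of_bool (letter_f n i x \<noteq> None) :: nat) = Suc (of_bool (letter_f n i y \<noteq> None)) \<and>
        (of_bool (letter_e n i y \<noteq> None) :: nat) = Suc (of_bool (letter_e n i x \<noteq> None))"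
      by (cases x) (auto simp: letter_crystal_def split: if_splits)
  qed (simp add: letter_crystal_def)
  ultimately show "normal (letter_crystal n) i UNIV"
    "eps (letter_crystal n) i l = of_bool (letter_e n i l \<noteq> None)"
    "phi (letter_crystal n) i l = of_bool (letter_f n i l \<noteq> None)"
    using normal_gradings[of "letter_crystal n" i UNIV] by blast+
qed

lemma letter_f_op: "f_op (letter_crystal n) = letter_f n"
  by (simp add: letter_crystal_def)

lemma letter_word:
  assumes "1 \<le> i"
  shows "eps (tensor_list (letter_crystal n)) i w = list_eps (letter_crystal n) i w"
    and "phi (tensor_list (letter_crystal n)) i w = list_phi (letter_crystal n) i w"
  using normal_tensor_list[OF normal_letter(1)[OF assms]] by simp_all

text \<open>On a column with both 1 and its bar, \<open>f\<^sub>0\<close> would produce a second 1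
  without raising \<open>\<epsilon>\<^sub>0\<close>. For the other indices every word behaves
  well.\<close>

abbreviation good_columns :: "nat \<Rightarrow> column set" where
  "good_columns i \<equiv> (if i = 0 then {b. \<not> (Unbarred 1 \<in> set b \<and> Barred 1 \<in> set b)} else UNIV)"

lemma column_nonzero:
  assumes "1 \<le> i"
  shows "normal (column_crystal n) i UNIV"
    and "eps (column_crystal n) i b = list_eps (letter_crystal n) i (rev b)"
    and "phi (column_crystal n) i b = list_phi (letter_crystal n) i (rev b)"
proof -
  let ?L = "tensor_list (letter_crystal n)"
  have n: "graded_by (e_op ?L i) UNIV (eps ?L i) (phi ?L i)"
    "graded_by (f_op ?L i) UNIV (phi ?L i) (eps ?L i)"
    using normal_tensor_list(1)[OF normal_letter(1)[OF assms]] by (simp_all add: normal_def)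
  have "graded_by (e_op (column_crystal n) i) UNIV (\<lambda>b. eps ?L i (rev b)) (\<lambda>b. phi ?L i (rev b))"
    using assms graded_by_None[OF n(1)] graded_by_Some[OF n(1)]
    by (intro graded_byI) (auto simp: column_crystal_def)
  moreover have "graded_by (f_op (column_crystal n) i) UNIV (\<lambda>b. phi ?L i (rev b)) (\<lambda>b. eps ?L i (rev b))"
    using assms graded_by_None[OF n(2)] graded_by_Some[OF n(2)]
    by (intro graded_byI) (auto simp: column_crystal_def)
  ultimately show "normal (column_crystal n) i UNIV"
    "eps (column_crystal n) i b = list_eps (letter_crystal n) i (rev b)"
    "phi (column_crystal n) i b = list_phi (letter_crystal n) i (rev b)"
    using normal_gradings[of "column_crystal n" i UNIV] letter_word[OF assms] by fastforce+
qed

lemma column_zero: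
  shows "normal (column_crystal n) 0 (good_columns 0)"
    and "b \<in> good_columns 0 \<Longrightarrow> eps (column_crystal n) 0 b = of_bool (Unbarred 1 \<in> set b)"
    and "b \<in> good_columns 0 \<Longrightarrow> phi (column_crystal n) 0 b = of_bool (Barred 1 \<in> set b)"
proof -
  have "graded_by (e_op (column_crystal n) 0) (good_columns 0)
      (\<lambda>b. of_bool (Unbarred 1 \<in> set b)) (\<lambda>b. of_bool (Barred 1 \<in> set b))"
    by (intro graded_byI) (auto simp: column_crystal_def replace_letter_def split: if_splits)
  moreover have "graded_by (f_op (column_crystal n) 0) (good_columns 0)
      (\<lambda>b. of_bool (Barred 1 \<in> set b)) (\<lambda>b. of_bool (Unbarred 1 \<in> set b))"
    by (intro graded_byI) (auto simp: column_crystal_def replace_letter_def split: if_splits)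
  ultimately show "normal (column_crystal n) 0 (good_columns 0)"
    "b \<in> good_columns 0 \<Longrightarrow> eps (column_crystal n) 0 b = of_bool (Unbarred 1 \<in> set b)"
    "b \<in> good_columns 0 \<Longrightarrow> phi (column_crystal n) 0 b = of_bool (Barred 1 \<in> set b)"
    using normal_gradings[of "column_crystal n" 0 "good_columns 0"] by blast+
qed

lemma normal_column: "normal (column_crystal n) i (good_columns i)"
  using column_nonzero(1)[of i n] column_zero(1)[of n] by (cases "i = 0") simp_all

section \<open>Deleting letters on which the operators vanish\<close>

definition neutral :: "nat \<Rightarrow> nat \<Rightarrow> letter \<Rightarrow> bool" where
  "neutral n i l \<longleftrightarrow> letter_e n i l = None \<and> letter_f n i l = None"

text \<open>A letter with \<epsilon> and \<phi> both 0 contributes nothing to the tensor rule. The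
  rule selects it only when \<phi> of the rest is 0, and then \<open>f\<^sub>i\<close> is undefined
  on the rest as well.\<close>

lemma neutral_append:
  assumes "1 \<le> i" and "\<forall>l\<in>set P. neutral n i l"
  shows "list_eps (letter_crystal n) i (P @ w) = list_eps (letter_crystal n) i w"
    and "list_phi (letter_crystal n) i (P @ w) = list_phi (letter_crystal n) i w"
    and "f_op (tensor_list (letter_crystal n)) i (P @ w) =
      map_option ((@) P) (f_op (tensor_list (letter_crystal n)) i w)"
proof -
  have 1: "list_eps (letter_crystal n) i (P @ w) = list_eps (letter_crystal n) i w \<and>
    list_phi (letter_crystal n) i (P @ w) = list_phi (letter_crystal n) i w"
    using assms(2) by (induction P) (simp_all add: normal_letter[OF assms(1)] neutral_def)
  then show "list_eps (letter_crystal n) i (P @ w) = list_eps (letter_crystal n) i w"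
    "list_phi (letter_crystal n) i (P @ w) = list_phi (letter_crystal n) i w" by simp_all
  have n: "graded_by (f_op (tensor_list (letter_crystal n)) i) UNIV
      (list_phi (letter_crystal n) i) (list_eps (letter_crystal n) i)"
    using normal_tensor_list(1)[OF normal_letter(1)[OF assms(1)]]
    by (simp add: normal_def letter_word[OF assms(1), abs_def])
  show "f_op (tensor_list (letter_crystal n)) i (P @ w) =
      map_option ((@) P) (f_op (tensor_list (letter_crystal n)) i w)"
    using assms(2)
  proof (induction P)
    case Nil
    then show ?case by (simp add: option.map_ident)
  next
    case (Cons x P)
    have "f_op (letter_crystal n) i x = None"
      using Cons.prems by (simp add: neutral_def letter_crystal_def)
    then show ?case
      using Cons graded_by_None[OF n, of "P @ w"]
      by (auto simp: tensor_list_Cons letter_word[OF assms(1)] normal_letter[OF assms(1)]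
          neutral_def option.map_comp comp_def)
  qed
qed

section \<open>Columns described by their sets of letters\<close>

abbreviation col :: "letter set \<Rightarrow> column" where
  "col \<equiv> sorted_list_of_set"

lemma col_eqI: "finite X \<Longrightarrow> sorted_wrt (<) b \<Longrightarrow> set b = X \<Longrightarrow> col X = b"
  using strict_sorted_equal[of b "col X"] by simp

text \<open>Only the four letters \<open>i\<close>, \<open>i + 1\<close> and their bars are seen by
  index \<open>i\<close>; they are cut out of the reading word. \<open>A\<close>, \<open>B\<close>,
  \<open>C\<close> are fixed before \<open>Y\<close>, so that one decomposition serves a column and
  its images under \<open>f\<^sub>i\<close> alike.\<close>

lemma rev_col_mid:
  fixes i :: nat
  assumes "finite X" and "1 \<le> i" and "i < n"
  obtains A B C where "\<forall>l\<in>set A \<union> set B \<union> set C. neutral n i l"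
    and "\<And>Y. Y - {Unbarred i, Unbarred (i + 1), Barred (i + 1), Barred i} =
           X - {Unbarred i, Unbarred (i + 1), Barred (i + 1), Barred i} \<Longrightarrow>
         rev (col Y) = A @ (if Barred i \<in> Y then [Barred i] else []) @
           (if Barred (i + 1) \<in> Y then [Barred (i + 1)] else []) @ B @
           (if Unbarred (i + 1) \<in> Y then [Unbarred (i + 1)] else []) @
           (if Unbarred i \<in> Y then [Unbarred i] else []) @ C"
proof -
  let ?M = "{Unbarred i, Unbarred (i + 1), Barred (i + 1), Barred i}"
  define L where "L = {l \<in> X. l < Unbarred i}"
  define M where "M = {l \<in> X. Unbarred (i + 1) < l \<and> l < Barred (i + 1)}"
  define R where "R = {l \<in> X. Barred i < l}"
  have fin: "finite L" "finite M" "finite R"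
    using assms(1) by (simp_all add: L_def M_def R_def)
  have LMR: "l \<in> L \<union> M \<union> R \<longleftrightarrow> l \<in> X \<and> l \<notin> ?M" for l
    by (cases l) (auto simp: L_def M_def R_def)
  show thesis
  proof (rule that[of "rev (col R)" "rev (col M)" "rev (col L)"])
    have "neutral n i l" if "l \<notin> ?M" for l
      using that assms by (cases l) (auto simp: neutral_def)
    then show "\<forall>l\<in>set (rev (col R)) \<union> set (rev (col M)) \<union> set (rev (col L)). neutral n i l"
      using LMR fin by auto
  next
    fix Y assume Y: "Y - ?M = X - ?M"
    then have "finite Y" using assms(1) by (metis finite.emptyI finite_Diff2 finite_insert)
    \<comment> \<open>All four letters are listed, present or not. Filtering by \<open>Y\<close>
      keeps the list strictly increasing and so treats all sixteen cases at once.\<close>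
    let ?w = "col L @ [Unbarred i, Unbarred (i + 1)] @ col M @ [Barred (i + 1), Barred i] @ col R"
    have L: "l < Unbarred i \<and> l < Unbarred (i + 1) \<and> l < Barred (i + 1) \<and> l < Barred i \<and>
        (\<forall>m\<in>M. l < m) \<and> (\<forall>r\<in>R. l < r)" if "l \<in> L" for l
    proof -
      have "l < Unbarred i" using that by (simp add: L_def)
      then obtain z where "l = Unbarred z" "z < i" by (cases l) auto
      then show ?thesis by (auto simp: M_def R_def elim: less_trans[rotated])
    qed
    have M: "Unbarred i < m \<and> Unbarred (i + 1) < m \<and> m < Barred (i + 1) \<and> m < Barred i \<and>
        (\<forall>r\<in>R. m < r)" if "m \<in> M" for m
    proof -
      have "Unbarred (i + 1) < m" "m < Barred (i + 1)" using that by (simp_all add: M_def)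
      then show ?thesis by (cases m) (auto simp: R_def elim: less_trans[rotated])
    qed
    have R: "Unbarred i < r \<and> Unbarred (i + 1) < r \<and> Barred (i + 1) < r \<and> Barred i < r"
      if "r \<in> R" for r
      using that by (cases r) (auto simp: R_def)
    have "sorted_wrt (<) ?w"
      using fin L M R by (simp add: sorted_wrt_append ball_Un)
    then have "sorted_wrt (<) (filter (\<lambda>l. l \<in> Y) ?w)"
      by (rule sorted_wrt_filter)
    moreover have YX: "l \<in> Y \<longleftrightarrow> l \<in> X" if "l \<notin> ?M" for l
      using Y that by blast
    have set_w: "set ?w = L \<union> M \<union> R \<union> ?M"
      using fin by auto
    have "Y \<subseteq> set ?w"
      unfolding set_w using LMR YX by blast
    then have "set (filter (\<lambda>l. l \<in> Y) ?w) = Y"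
      by (simp only: set_filter) blast
    ultimately have "col Y = filter (\<lambda>l. l \<in> Y) ?w"
      by (intro col_eqI \<open>finite Y\<close>)
    moreover have "filter (\<lambda>l. l \<in> Y) (col L) = col L" "filter (\<lambda>l. l \<in> Y) (col M) = col M"
      "filter (\<lambda>l. l \<in> Y) (col R) = col R"
      unfolding filter_id_conv using LMR YX fin by simp_all blast+
    ultimately have "col Y = col L @ (if Unbarred i \<in> Y then [Unbarred i] else []) @
        (if Unbarred (i + 1) \<in> Y then [Unbarred (i + 1)] else []) @ col M @
        (if Barred (i + 1) \<in> Y then [Barred (i + 1)] else []) @
        (if Barred i \<in> Y then [Barred i] else []) @ col R"
      by simp
    then show "rev (col Y) = rev (col R) @ (if Barred i \<in> Y then [Barred i] else []) @
           (if Barred (i + 1) \<in> Y then [Barred (i + 1)] else []) @ rev (col M) @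
           (if Unbarred (i + 1) \<in> Y then [Unbarred (i + 1)] else []) @
           (if Unbarred i \<in> Y then [Unbarred i] else []) @ rev (col L)"
      by simp
  qed
qed


text \<open>The tensor rule on the reduced word: bar of \<open>i\<close>, bar of
  \<open>i + 1\<close>, then \<open>i + 1\<close>, \<open>i\<close>, each if present. In the last
  claim the letter \<open>i\<close>, being rightmost, moves first even if the bar of
  \<open>i + 1\<close> is present.\<close>

lemma column_mid:
  fixes i :: nat
  assumes "finite X" and "1 \<le> i" and "i < n"
  shows "eps (column_crystal n) i (col X) =
      (of_bool (Unbarred (i + 1) \<in> X) - of_bool (Unbarred i \<in> X)) +
      (of_bool (Barred i \<in> X) - (of_bool (Barred (i + 1) \<in> X) +
        (of_bool (Unbarred i \<in> X) - of_bool (Unbarred (i + 1) \<in> X))))" (is ?eps)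
    and "phi (column_crystal n) i (col X) =
      (of_bool (Barred (i + 1) \<in> X) +
        (of_bool (Unbarred i \<in> X) - of_bool (Unbarred (i + 1) \<in> X))) - of_bool (Barred i \<in> X)"
      (is ?phi)
    and "\<lbrakk>Barred (i + 1) \<in> X; Barred i \<notin> X; Unbarred i \<in> X \<longrightarrow> Unbarred (i + 1) \<in> X\<rbrakk> \<Longrightarrow>
      f_op (column_crystal n) i (col X) = Some (col (insert (Barred i) (X - {Barred (i + 1)})))"
    and "\<lbrakk>Unbarred i \<in> X; Unbarred (i + 1) \<notin> X; Barred i \<notin> X\<rbrakk> \<Longrightarrow>
      f_op (column_crystal n) i (col X) = Some (col (insert (Unbarred (i + 1)) (X - {Unbarred i})))"
proof -
  obtain A B C where neutral: "\<forall>l\<in>set A \<union> set B \<union> set C. neutral n i l"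
    and rev: "\<And>Y. Y - {Unbarred i, Unbarred (i + 1), Barred (i + 1), Barred i} =
           X - {Unbarred i, Unbarred (i + 1), Barred (i + 1), Barred i} \<Longrightarrow>
         rev (col Y) = A @ (if Barred i \<in> Y then [Barred i] else []) @
           (if Barred (i + 1) \<in> Y then [Barred (i + 1)] else []) @ B @
           (if Unbarred (i + 1) \<in> Y then [Unbarred (i + 1)] else []) @
           (if Unbarred i \<in> Y then [Unbarred i] else []) @ C"
    using rev_col_mid[OF assms] by metis
  have ABC: "\<forall>l\<in>set A. neutral n i l" "\<forall>l\<in>set B. neutral n i l" "\<forall>l\<in>set C. neutral n i l"
    using neutral by auto
  note app = ABC[THEN neutral_append(1)[OF assms(2)]] ABC[THEN neutral_append(2)[OF assms(2)]]
    ABC[THEN neutral_append(3)[OF assms(2)]]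
  note C = neutral_append(1,2,3)[OF assms(2) ABC(3), of "[]", simplified]
  note letters = normal_letter(2,3)[OF assms(2)]
  note revX = rev[OF refl]
  show ?eps
    unfolding column_nonzero[OF assms(2)] revX
    using assms by (simp add: app C letters)
  show ?phi
    unfolding column_nonzero[OF assms(2)] revX
    using assms by (simp add: app C letters)
  have f: "f_op (column_crystal n) i (col X) = Some (col Y)"
    if "f_op (tensor_list (letter_crystal n)) i (rev (col X)) = Some (rev (col Y))" for Y
    using that assms by (simp add: column_crystal_def)
  show "f_op (column_crystal n) i (col X) = Some (col (insert (Barred i) (X - {Barred (i + 1)})))"
    if "Barred (i + 1) \<in> X" "Barred i \<notin> X" "Unbarred i \<in> X \<longrightarrow> Unbarred (i + 1) \<in> X"
  proof (rule f)
    have revY: "rev (col (insert (Barred i) (X - {Barred (i + 1)}))) = A @ [Barred i] @ B @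
           (if Unbarred (i + 1) \<in> X then [Unbarred (i + 1)] else []) @
           (if Unbarred i \<in> X then [Unbarred i] else []) @ C"
      by (subst rev) auto
    show "f_op (tensor_list (letter_crystal n)) i (rev (col X)) =
        Some (rev (col (insert (Barred i) (X - {Barred (i + 1)}))))"
      unfolding revX revY using that assms
      by (simp add: tensor_list_Cons tensor_list_Nil app C letters letter_word letter_f_op)
  qed
  show "f_op (column_crystal n) i (col X) = Some (col (insert (Unbarred (i + 1)) (X - {Unbarred i})))"
    if "Unbarred i \<in> X" "Unbarred (i + 1) \<notin> X" "Barred i \<notin> X"
  proof (rule f)
    have revY: "rev (col (insert (Unbarred (i + 1)) (X - {Unbarred i}))) = A @
           (if Barred (i + 1) \<in> X then [Barred (i + 1)] else []) @ B @ [Unbarred (i + 1)] @ C"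
      using that by (subst rev) auto
    show "f_op (tensor_list (letter_crystal n)) i (rev (col X)) =
        Some (rev (col (insert (Unbarred (i + 1)) (X - {Unbarred i}))))"
      unfolding revX revY using that assms
      by (simp add: tensor_list_Cons tensor_list_Nil app C letters letter_word letter_f_op)
  qed
qed

text \<open>Inside the alphabet no letter lies between \<open>n\<close> and its bar, so the reading
  word is a neutral block, these two letters, and another neutral block.\<close>

lemma column_top:
  assumes "X \<subseteq> alphabet n" and "1 \<le> n"
  shows "eps (column_crystal n) n (col X) = of_bool (Barred n \<in> X \<and> Unbarred n \<notin> X)"
    and "phi (column_crystal n) n (col X) = of_bool (Unbarred n \<in> X \<and> Barred n \<notin> X)"
    and "\<lbrakk>Unbarred n \<in> X; Barred n \<notin> X\<rbrakk> \<Longrightarrow>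
      f_op (column_crystal n) n (col X) = Some (col (insert (Barred n) (X - {Unbarred n})))"
proof -
  let ?M = "{Unbarred n, Barred n}"
  define L where "L = {l \<in> X. l < Unbarred n}"
  define R where "R = {l \<in> X. Barred n < l}"
  have fin: "finite X"
    using assms(1) by (rule finite_subset) (simp add: alphabet_def)
  then have finLR: "finite L" "finite R"
    by (simp_all add: L_def R_def)
  have LR: "l \<in> L \<union> R \<longleftrightarrow> l \<in> X \<and> l \<notin> ?M" for l
    using assms(1) by (cases l) (auto simp: L_def R_def alphabet_def)
  have neutral: "\<forall>l\<in>set (rev (col L)). neutral n n l" "\<forall>l\<in>set (rev (col R)). neutral n n l"
  proof -
    have "neutral n n l" if "l \<notin> ?M" for l
      using that by (cases l) (auto simp: neutral_def)
    then show "\<forall>l\<in>set (rev (col L)). neutral n n l" "\<forall>l\<in>set (rev (col R)). neutral n n l"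
      using finLR LR by auto
  qed
  have rev: "rev (col Y) = rev (col R) @ (if Barred n \<in> Y then [Barred n] else []) @
      (if Unbarred n \<in> Y then [Unbarred n] else []) @ rev (col L)"
    if Y: "Y - ?M = X - ?M" for Y
  proof -
    have "finite Y" using fin Y by (metis finite.emptyI finite_Diff2 finite_insert)
    have lr: "l < Unbarred n \<and> l < Barred n \<and> (\<forall>r\<in>R. l < r)" if "l \<in> L" for l
      using that by (cases l) (auto simp: L_def R_def elim: less_trans[rotated])
    have r: "Unbarred n < r \<and> Barred n < r" if "r \<in> R" for r
      using that by (cases r) (auto simp: R_def)
    have "col Y = col L @ (if Unbarred n \<in> Y then [Unbarred n] else []) @
        (if Barred n \<in> Y then [Barred n] else []) @ col R" (is "_ = ?b")
    proof (rule col_eqI[OF \<open>finite Y\<close>])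
      show "sorted_wrt (<) ?b"
        using finLR lr r by (simp add: sorted_wrt_append ball_Un)
      have YX: "l \<in> Y \<longleftrightarrow> l \<in> X" if "l \<notin> ?M" for l
        using Y that by blast
      have "set ?b = L \<union> R \<union> (Y \<inter> ?M)"
        using finLR by auto
      also have "\<dots> = Y"
        using LR YX by blast
      finally show "set ?b = Y" .
    qed
    then show ?thesis by simp
  qed
  note app = neutral[THEN neutral_append(1)[OF assms(2)]] neutral[THEN neutral_append(2)[OF assms(2)]]
    neutral[THEN neutral_append(3)[OF assms(2)]]
  note L = neutral_append(1,2,3)[OF assms(2) neutral(1), of "[]", unfolded append_Nil2]
  note letters = normal_letter(2,3)[OF assms(2)]
  note revX = rev[OF refl]
  show "eps (column_crystal n) n (col X) = of_bool (Barred n \<in> X \<and> Unbarred n \<notin> X)"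
    unfolding column_nonzero[OF assms(2)] revX
    by (simp add: app L letters)
  show "phi (column_crystal n) n (col X) = of_bool (Unbarred n \<in> X \<and> Barred n \<notin> X)"
    unfolding column_nonzero[OF assms(2)] revX
    by (simp add: app L letters)
  show "f_op (column_crystal n) n (col X) = Some (col (insert (Barred n) (X - {Unbarred n})))"
    if "Unbarred n \<in> X" "Barred n \<notin> X"
  proof -
    have revY: "rev (col (insert (Barred n) (X - {Unbarred n}))) = rev (col R) @ [Barred n] @ rev (col L)"
      by (subst rev) auto
    have "f_op (tensor_list (letter_crystal n)) n (rev (col X)) =
        Some (rev (col (insert (Barred n) (X - {Unbarred n}))))"
      unfolding revX revY using that assms(2)
      by (simp add: tensor_list_Cons tensor_list_Nil app L letters letter_word letter_f_op)
    then show ?thesis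
      using assms(2) by (simp add: column_crystal_def)
  qed
qed

lemma column_affine:
  assumes "finite X" and "Barred 1 \<in> X" and "Unbarred 1 \<notin> X"
  shows "f_op (column_crystal n) 0 (col X) = Some (col (insert (Unbarred 1) (X - {Barred 1})))"
proof -
  let ?g = "\<lambda>l. if l = Barred 1 then Unbarred 1 else l"
  \<comment> \<open>As 1 is absent, the replacement creates no repetition, and sorting yields a
    strictly increasing column again.\<close>
  have "inj_on ?g X"
    using assms(3) by (auto simp: inj_on_def)
  then have "distinct (map ?g (col X))"
    using assms(1) by (simp add: distinct_map)
  moreover have "set (map ?g (col X)) = insert (Unbarred 1) (X - {Barred 1})"
    using assms by auto
  ultimately have "sort (map ?g (col X)) = col (insert (Unbarred 1) (X - {Barred 1}))"
    by (metis sorted_list_of_set_sort_remdups distinct_remdups_id)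
  then show ?thesis
    using assms by (simp add: column_crystal_def replace_letter_def del: One_nat_def)
qed

section \<open>Full strings in terms of the unbarred and the barred letters\<close>

definition letters :: "nat set \<Rightarrow> nat set \<Rightarrow> letter set" where
  "letters U V = Unbarred ` U \<union> Barred ` V"

lemma letters_simps [simp]:
  "Unbarred z \<in> letters U V \<longleftrightarrow> z \<in> U"
  "Barred z \<in> letters U V \<longleftrightarrow> z \<in> V"
  "insert (Unbarred z) (letters U V) = letters (insert z U) V"
  "insert (Barred z) (letters U V) = letters U (insert z V)"
  "letters U V - {Unbarred z} = letters (U - {z}) V"
  "letters U V - {Barred z} = letters U (V - {z})"
  "finite U \<Longrightarrow> finite V \<Longrightarrow> finite (letters U V)"
  by (auto simp: letters_def)

lemma letters_subset_alphabet:
  "letters U V \<subseteq> alphabet n \<longleftrightarrow> U \<subseteq> {1..n} \<and> V \<subseteq> {1..n}"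
  by (auto simp: letters_def alphabet_def)

text \<open>If the bar of \<open>i\<close> is absent, two moves take place independently:
  \<open>i\<close> goes to \<open>i + 1\<close> when that place is free, and the bar of
  \<open>i + 1\<close> goes to the bar of \<open>i\<close>. If the bar of \<open>i\<close> is
  present, the side condition says that \<phi> is 0, so nothing moves.\<close>

lemma full_string_mid:
  fixes i :: nat
  assumes "finite U" and "finite V" and "1 \<le> i" and "i < n"
    and "E i = (of_bool (i + 1 \<in> U) - of_bool (i \<in> U)) +
      (of_bool (i \<in> V) - (of_bool (i + 1 \<in> V) + (of_bool (i \<in> U) - of_bool (i + 1 \<in> U))))"
    and "i \<in> V \<Longrightarrow> (i + 1 \<in> V \<and> i \<in> U \<longrightarrow> i + 1 \<in> U) \<and> U' = U \<and> V' = V"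
    and "i \<notin> V \<Longrightarrow> U' = (if i \<in> U \<and> i + 1 \<notin> U then insert (i + 1) (U - {i}) else U) \<and>
      V' = (if i + 1 \<in> V then insert i (V - {i + 1}) else V)"
  shows "full_string (column_crystal n) good_columns E i (col (letters U V)) (col (letters U' V'))"
proof -
  have fin: "finite (letters U V)" using assms by simp
  note c = column_mid[OF fin assms(3,4)]
  have "iter_op (f_op (column_crystal n) i) (phi (column_crystal n) i (col (letters U V)))
      (col (letters U V)) = Some (col (letters U' V'))"
  proof (cases "i \<in> V")
    case True
    then show ?thesis using assms(6) by (simp add: c(2))
  next
    case False
    show ?thesis
    proof (cases "i \<in> U \<and> i + 1 \<notin> U")
      case True
      then have f: "f_op (column_crystal n) i (col (letters U V)) =
          Some (col (letters (insert (i + 1) (U - {i})) V))"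
        using c(4) False by simp
      show ?thesis
      proof (cases "i + 1 \<in> V")
        case V: True
        have "f_op (column_crystal n) i (col (letters (insert (i + 1) (U - {i})) V)) =
          Some (col (letters (insert (i + 1) (U - {i})) (insert i (V - {i + 1}))))"
          using column_mid(3)[of "letters (insert (i + 1) (U - {i})) V" i n] assms(1-4) V False by simp
        then show ?thesis
          using assms(7) f True False V by (simp add: c(2))
      next
        case V: False
        then show ?thesis
          using assms(7) f True False by (simp add: c(2))
      qed
    next
      case U: False
      show ?thesis
      proof (cases "i + 1 \<in> V")
        case True
        then have "f_op (column_crystal n) i (col (letters U V)) =
          Some (col (letters U (insert i (V - {i + 1}))))"
          using c(3) False U by auto
        moreover have "phi (column_crystal n) i (col (letters U V)) = 1"
          using c(2) False U True by auto
        ultimately show ?thesis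
          using assms(7) True False U by auto
      next
        case V: False
        have "phi (column_crystal n) i (col (letters U V)) = 0"
          using c(2) False U V by auto
        then show ?thesis
          using assms(7) False U V by auto
      qed
    qed
  qed
  then show ?thesis
    using assms(3,5) by (simp add: full_string_def c(1))
qed

lemma full_string_top:
  assumes "U \<subseteq> {1..n}" and "V \<subseteq> {1..n}" and "1 \<le> n" and "E n = of_bool (n \<in> V \<and> n \<notin> U)"
    and "U' = (if n \<in> V then U else U - {n})"
    and "V' = (if n \<in> U then insert n V else V)"
  shows "full_string (column_crystal n) good_columns E n (col (letters U V)) (col (letters U' V'))"
proof -
  have "letters U V \<subseteq> alphabet n" using assms by (simp add: letters_subset_alphabet)
  note c = column_top[OF this assms(3)]
  have "iter_op (f_op (column_crystal n) n) (phi (column_crystal n) n (col (letters U V)))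
      (col (letters U V)) = Some (col (letters U' V'))"
  proof (cases "n \<in> U \<and> n \<notin> V")
    case True
    then show ?thesis using assms c by simp
  next
    case False
    then have "U' = U" "V' = V" using assms(5,6) by auto
    with False show ?thesis by (auto simp: c(2))
  qed
  then show ?thesis
    using assms(3,4) by (simp add: full_string_def c(1))
qed

lemma full_string_affine:
  assumes "finite U" and "finite V" and "\<not> (1 \<in> U \<and> 1 \<in> V)" and "E 0 = of_bool (1 \<in> U)"
    and "U' = (if 1 \<in> V then insert 1 U else U)" and "V' = V - {1}"
  shows "full_string (column_crystal n) good_columns E 0 (col (letters U V)) (col (letters U' V'))"
proof -
  have good: "col (letters U V) \<in> good_columns 0" using assms(1-3) by simp
  have "iter_op (f_op (column_crystal n) 0) (phi (column_crystal n) 0 (col (letters U V)))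
      (col (letters U V)) = Some (col (letters U' V'))"
  proof (cases "1 \<in> V")
    case True
    then show ?thesis using assms column_zero(3)[OF good] column_affine[of "letters U V"] by simp
  next
    case False
    then show ?thesis using assms column_zero(3)[OF good] by simp
  qed
  then show ?thesis
    using assms(1,2,4) good column_zero(2)[OF good] by (simp add: full_string_def)
qed

section \<open>One turn of the column\<close>

abbreviation turn :: "nat \<Rightarrow> nat list" where
  "turn n \<equiv> rev [0..<Suc n]"

text \<open>Each \<open>f\<^sub>i\<close> with \<open>1 \<le> i < n\<close> acts when
  \<open>i + 1\<close> is free and the bar of \<open>i\<close> is absent, so \<epsilon> is 0 and
  \<open>i\<close> moves up. If \<open>n\<close> occurs, it becomes a bar that descends along with
  these moves and ends as the letter 1.\<close>

lemma turn_unbarred: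
  assumes "1 \<le> n" and S: "S \<subseteq> {1..n}"
  shows "\<exists>S'\<subseteq>{1..n}. full_strings (column_crystal n) good_columns (\<lambda>_. 0) (turn n)
    (col (letters S {})) (col (letters S' {}))"
proof -
  \<comment> \<open>The state just before index \<open>i - 1\<close> acts: letters below
    \<open>i\<close> are still in place, those above are already shifted, place \<open>i\<close> is
    vacant, and the bar coming from \<open>n\<close> is at \<open>i\<close>. At \<open>i = 0\<close>
    this bar has become 1.\<close>
  define U where "U i = {z\<in>{1..n}. z < i \<and> z \<in> S \<or> i < z \<and> z - 1 \<in> S \<or> i = 0 \<and> z = 1 \<and> n \<in> S}" for i
  define V where "V i = (if n \<in> S \<and> 1 \<le> i \<and> i \<le> n then {i} else {})" for i
  have U: "U i \<subseteq> {1..n}" and fin: "finite (U i)" "finite (V i)" for i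
    by (auto simp: U_def V_def)
  \<comment> \<open>For \<open>z = 1\<close> the value \<open>z - 1\<close> is 0, which therefore
    yields no spurious shifted letter.\<close>
  have zero: "0 \<notin> S" using S by auto
  have step: "full_string (column_crystal n) good_columns (\<lambda>_. 0) i
      (col (letters (U (Suc i)) (V (Suc i)))) (col (letters (U i) (V i)))" if i: "i < Suc n" for i
  proof -
    consider "i = 0" | "i = n" "1 \<le> i" | "1 \<le> i" "i < n"
      using i by linarith
    then show ?thesis
    proof cases
      case 1
      have "1 \<notin> U (Suc 0)" by (simp add: U_def)
      moreover have "U 0 = (if 1 \<in> V (Suc 0) then insert 1 (U (Suc 0)) else U (Suc 0))"
        using assms(1) zero by (auto simp: U_def V_def intro: Suc_lessI)
      ultimately show ?thesis
        unfolding 1 by (intro full_string_affine fin) (auto simp: V_def)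
    next
      case 2
      have "U n = U (Suc n) - {n}" "V (Suc n) = {}" "V n = (if n \<in> U (Suc n) then {n} else {})"
        using 2 by (auto simp: U_def V_def)
      then show ?thesis
        unfolding \<open>i = n\<close> using 2 U[of "Suc n"] by (intro full_string_top) auto
    next
      case 3
      have p: "i \<in> U (Suc i) \<longleftrightarrow> i \<in> S" "i + 1 \<notin> U (Suc i)" "i \<notin> V (Suc i)"
        "i + 1 \<in> V (Suc i) \<longleftrightarrow> n \<in> S"
        using 3 by (auto simp: U_def V_def)
      have "z \<in> U i \<longleftrightarrow> z \<in> (if i \<in> S then insert (i + 1) (U (Suc i) - {i}) else U (Suc i))" for z
      proof -
        consider "z < i" | "z = i" | "z = Suc i" | "Suc i < z" by linarith
        then show ?thesis by cases (use 3 in \<open>auto simp: U_def\<close>)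
      qed
      then have "U i = (if i \<in> S then insert (i + 1) (U (Suc i) - {i}) else U (Suc i))"
        by blast
      moreover have "V i = (if n \<in> S then insert i (V (Suc i) - {i + 1}) else V (Suc i))"
        using 3 by (auto simp: V_def)
      ultimately show ?thesis
        by (intro full_string_mid fin 3) (simp_all add: p[simplified])
    qed
  qed
  have "full_strings (column_crystal n) good_columns (\<lambda>_. 0) (turn n)
      (col (letters (U (Suc n)) (V (Suc n)))) (col (letters (U 0) (V 0)))"
    using full_strings_downto[where k = "Suc n" and X = "\<lambda>i. col (letters (U i) (V i))", OF step] .
  moreover have "U (Suc n) = S" using S zero by (auto simp: U_def)
  moreover have "V (Suc n) = {}" "V 0 = {}" by (simp_all add: V_def)
  ultimately show ?thesis using U[of 0] by auto
qed

text \<open>The lowest bar, at \<open>d + 1\<close>, runs down to a new letter 1 and pushes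
  \<open>1, \<dots>, h\<close> up by one. By \<open>h < a\<close> they stay below the block from
  \<open>a + 1\<close>. The higher bars cancel every move above \<open>d\<close>. In the iteration
  \<open>d\<close> grows by one with each turn.\<close>

lemma turn_ground:
  assumes "h < a" and "a \<le> c" and "c \<le> n" and "h \<le> d" and "d < c"
  shows "full_strings (column_crystal n) good_columns (\<lambda>i. of_bool (i = a)) (turn n)
    (col (letters ({1..h} \<union> {a+1..c}) {d+1..c})) (col (letters ({1..h+1} \<union> {a+1..c}) {d+2..c}))"
proof -
  \<comment> \<open>The column just before \<open>f\<^bsub>i-1\<^esub>\<close> acts: the moving bar is at \<open>min i (d+1)\<close> and has pushed up the
     letters among \<open>1, \<dots>, h\<close> that it has met.\<close>
  define U where "U i = {z. 1 \<le> z \<and> (z < i \<and> z \<le> h \<or> i < z \<and> z \<le> h + 1)} \<union> {a+1..c}" for i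
  define V where "V i = {d+2..c} \<union> (if i = 0 then {} else {min i (d + 1)})" for i
  have fin: "finite (U i)" "finite (V i)" for i
    by (auto simp: U_def V_def intro: finite_subset[of _ "{..h+1}"])
  have step: "full_string (column_crystal n) good_columns (\<lambda>i. of_bool (i = a)) i
      (col (letters (U (Suc i)) (V (Suc i)))) (col (letters (U i) (V i)))" if i: "i < Suc n" for i
  proof -
    consider "i = 0" | "i = n" "1 \<le> i" | "1 \<le> i" "i < n"
      using i by linarith
    then show ?thesis
    proof cases
      case 1
      have "1 \<notin> U (Suc 0)" "1 \<in> V (Suc 0)" using assms by (auto simp: U_def V_def)
      moreover have "U 0 = insert 1 (U (Suc 0))" "V 0 = V (Suc 0) - {1}"
        using assms by (auto simp: U_def V_def)
      ultimately show ?thesis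
        unfolding 1 using assms by (intro full_string_affine fin) auto
    next
      case 2
      have "U n = U (Suc n)" "V n = V (Suc n)" "U n \<subseteq> {1..n}" "V n \<subseteq> {1..n}"
        using assms by (auto simp: U_def V_def)
      moreover have "n \<in> V n \<longleftrightarrow> n = c" "n \<in> U n \<longleftrightarrow> n = c \<and> a < n"
        using assms by (auto simp: U_def V_def)
      ultimately show ?thesis
        unfolding \<open>i = n\<close> using assms 2 by (intro full_string_top) auto
    next
      case 3
      have p: "i \<in> U (Suc i) \<longleftrightarrow> i \<le> h \<or> a < i \<and> i \<le> c"
          "i + 1 \<in> U (Suc i) \<longleftrightarrow> a \<le> i \<and> i < c"
          "i + 1 \<in> V (Suc i) \<longleftrightarrow> i < c"
          "i \<in> V (Suc i) \<longleftrightarrow> d < i \<and> i \<le> c"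
        using 3 assms by (auto simp: U_def V_def)
      show ?thesis
      proof (intro full_string_mid fin 3)
        \<comment> \<open>The unit at \<open>i = a\<close> comes from the letter
          \<open>a + 1\<close> if \<open>a < c\<close>, and from the bar of \<open>c\<close> if
          \<open>a = c\<close>.\<close>
        show "of_bool (i = a) = (of_bool (i + 1 \<in> U (Suc i)) - of_bool (i \<in> U (Suc i))) +
          (of_bool (i \<in> V (Suc i)) - (of_bool (i + 1 \<in> V (Suc i)) +
            (of_bool (i \<in> U (Suc i)) - of_bool (i + 1 \<in> U (Suc i)))) :: nat)"
          unfolding p using assms 3 by auto
        show "(i + 1 \<in> V (Suc i) \<and> i \<in> U (Suc i) \<longrightarrow> i + 1 \<in> U (Suc i)) \<and>
          U i = U (Suc i) \<and> V i = V (Suc i)" if "i \<in> V (Suc i)"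
          using that assms 3 unfolding p by (auto simp: U_def V_def)
        \<comment> \<open>Here \<open>i \<le> d\<close> or \<open>i > c\<close>. In the first case
          the moving bar steps from \<open>i + 1\<close> to \<open>i\<close>, and for
          \<open>i \<le> h\<close> the letter \<open>i\<close> moves too, since \<open>i + 1\<close>
          is free; in the second case nothing moves.\<close>
        show "U i = (if i \<in> U (Suc i) \<and> i + 1 \<notin> U (Suc i)
            then insert (i + 1) (U (Suc i) - {i}) else U (Suc i)) \<and>
          V i = (if i + 1 \<in> V (Suc i) then insert i (V (Suc i) - {i + 1}) else V (Suc i))"
          if "i \<notin> V (Suc i)"
          using that assms 3 unfolding p by (auto simp: U_def V_def)
      qed
    qed
  qed
  have "full_strings (column_crystal n) good_columns (\<lambda>i. of_bool (i = a)) (turn n)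
      (col (letters (U (Suc n)) (V (Suc n)))) (col (letters (U 0) (V 0)))"
    using full_strings_downto[where k = "Suc n" and X = "\<lambda>i. col (letters (U i) (V i))", OF step] .
  moreover have "U (Suc n) = {1..h} \<union> {a+1..c}" "U 0 = {1..h+1} \<union> {a+1..c}"
    "V (Suc n) = {d+1..c}" "V 0 = {d+2..c}"
    using assms by (auto simp: U_def V_def)
  ultimately show ?thesis by simp
qed

lemma set_turns: "set (concat (replicate k (turn n))) \<subseteq> {0..n}"
  by (induction k) auto

lemma turns_unbarred:
  assumes "1 \<le> n" and "S \<subseteq> {1..n}"
  shows "\<exists>S'\<subseteq>{1..n}. full_strings (column_crystal n) good_columns (\<lambda>_. 0)
    (concat (replicate m (turn n))) (col (letters S {})) (col (letters S' {}))"
  using assms(2)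
proof (induction m arbitrary: S)
  case 0
  then show ?case by (intro exI[of _ S]) simp
next
  case (Suc m)
  from turn_unbarred[OF assms(1) Suc.prems] obtain S1 where S1: "S1 \<subseteq> {1..n}"
    "full_strings (column_crystal n) good_columns (\<lambda>_. 0) (turn n) (col (letters S {})) (col (letters S1 {}))"
    by (elim exE conjE)
  from Suc.IH[OF S1(1)] obtain S2 where S2: "S2 \<subseteq> {1..n}"
    "full_strings (column_crystal n) good_columns (\<lambda>_. 0)
      (concat (replicate m (turn n))) (col (letters S1 {})) (col (letters S2 {}))"
    by (elim exE conjE)
  have "full_strings (column_crystal n) good_columns (\<lambda>_. 0)
      (turn n @ concat (replicate m (turn n))) (col (letters S {})) (col (letters S2 {}))"
    unfolding full_strings_append using S1(2) S2(2) by (intro exI conjI)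
  with S2(1) show ?case
    by (intro exI[of _ S2]) (simp only: replicate_Suc concat.simps simp_thms)
qed

section \<open>Ground states\<close>

text \<open>For \<open>z = 1\<close> the admissibility bound is \<open>r - 1\<close>, the largest
  possible difference of positions, so 1 and its bar never occur together.\<close>

lemma KN_column_good:
  assumes "b \<in> KN_columns n r" and "1 \<le> n"
  shows "b \<in> good_columns i"
proof -
  have False if "Unbarred 1 \<in> set b" "Barred 1 \<in> set b"
  proof -
    from that obtain p q where pq: "p < length b" "b ! p = Unbarred 1" "q < length b" "b ! q = Barred 1"
      by (metis in_set_conv_nth)
    have r: "length b = r" and no: "\<not> (\<exists>z\<in>{1..n}. \<exists>p\<in>{1..r}. \<exists>q\<in>{1..r}.
        b ! (p - 1) = Unbarred z \<and> b ! (q - 1) = Barred z \<and> int q - int p \<le> int r - int z)"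
      using assms(1) by (auto simp: KN_columns_def)
    have "\<exists>z\<in>{1..n}. \<exists>p\<in>{1..r}. \<exists>q\<in>{1..r}.
        b ! (p - 1) = Unbarred z \<and> b ! (q - 1) = Barred z \<and> int q - int p \<le> int r - int z"
      by (rule bexI[of _ 1], rule bexI[of _ "Suc p"], rule bexI[of _ "Suc q"]) (use pq r assms(2) in auto)
    with no show False by blast
  qed
  then show ?thesis by auto
qed

text \<open>The values of \<epsilon> become closure conditions: the unbarred letters form an
  interval starting at \<open>a + 1\<close>, and the barred ones an interval with the same top
  \<open>c\<close>. Admissibility at \<open>c\<close> bounds the number of bars.\<close>

lemma ground_column:
  assumes b: "b \<in> KN_columns n r" and "1 \<le> r" and "1 \<le> n" and "a \<le> n"
    and eps: "\<forall>i\<le>n. eps (column_crystal n) i b = of_bool (i = a)"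
  shows "\<exists>c d. a \<le> c \<and> d \<le> c \<and> c \<le> n \<and> c - d \<le> a \<and> b = col (letters {a+1..c} {d+1..c}) \<and>
    (\<forall>i\<le>n. phi (column_crystal n) i b = of_bool (i = d))"
proof -
  define U where "U = {z. Unbarred z \<in> set b}"
  define V where "V = {z. Barred z \<in> set b}"
  have "l \<in> set b \<longleftrightarrow> l \<in> letters U V" for l
    by (cases l) (auto simp: letters_def U_def V_def)
  then have "set b = letters U V" by blast
  moreover have sorted: "sorted_wrt (<) b" and alph: "set b \<subseteq> alphabet n" and len: "length b = r"
    using b by (auto simp: KN_columns_def)
  ultimately have b_eq: "b = col (letters U V)" and alph': "letters U V \<subseteq> alphabet n"
    using col_eqI[OF _ sorted] by (metis List.finite_set, simp)
  have UV: "U \<subseteq> {1..n}" "V \<subseteq> {1..n}"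
    using alph' by (simp_all add: letters_subset_alphabet)
  then have fin: "finite U" "finite V" by (auto intro: finite_subset)
  have good: "b \<in> good_columns 0" using KN_column_good[OF b assms(3)] .
  have zero: "1 \<in> U \<longleftrightarrow> a = 0"
    using eps[rule_format, of 0] column_zero(2)[OF good, of n] by (simp only: U_def mem_Collect_eq of_bool_eq_iff) auto
  have mid: "(of_bool (i + 1 \<in> U) - of_bool (i \<in> U)) +
      (of_bool (i \<in> V) - (of_bool (i + 1 \<in> V) + (of_bool (i \<in> U) - of_bool (i + 1 \<in> U)))) =
      (of_bool (i = a) :: nat)" if "1 \<le> i" "i < n" for i
    using eps[rule_format, of i] column_mid(1)[of "letters U V" i n] that fin by (simp add: b_eq)
  have top: "n \<in> V \<and> n \<notin> U \<longleftrightarrow> a = n"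
    using eps[rule_format, of n] column_top(1)[OF alph' assms(3)] by (auto simp: b_eq of_bool_eq_iff)

  have U_down: "z \<in> U" if "z + 1 \<in> U" "1 \<le> z" "z \<noteq> a" for z
    using mid[of z] that UV(1) by (cases "z \<in> U") auto
  \<comment> \<open>A letter at most \<open>a\<close> would force all smaller ones down to 1, and 1
    occurs only if \<open>a = 0\<close>.\<close>
  have U_gt: "a < z" if "z \<in> U" for z
  proof (rule ccontr)
    assume "\<not> a < z"
    then have "z \<in> U \<Longrightarrow> z \<le> a \<Longrightarrow> False"
    proof (induction z)
      case 0
      then show ?case using UV(1) by auto
    next
      case (Suc z)
      then show ?case using U_down[of z] zero by (cases "z = 0") auto
    qed
    with that \<open>\<not> a < z\<close> show False by simp
  qed
  \<comment> \<open>Inserting \<open>a\<close> gives \<open>c = a\<close> when there is no unbarred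
    letter.\<close>
  define c where "c = Max (insert a U)"
  have c: "a \<le> c" "c \<le> n" "c \<in> insert a U"
    using fin UV(1) assms(4) Max_in[of "insert a U"] by (auto simp: c_def)
  have U_eq: "U = {a+1..c}"
  proof
    show "U \<subseteq> {a+1..c}"
      using U_gt fin by (auto simp: c_def Suc_le_eq)
    have "z \<in> U" if "z \<le> c" "a < z" for z
      using that
    proof (induction rule: inc_induct)
      case base
      then show ?case using c(3) by auto
    next
      case (step z)
      then show ?case using U_down[of z] by auto
    qed
    then show "{a+1..c} \<subseteq> U" by auto
  qed

  \<comment> \<open>A bar of \<open>z\<close> without the bar of \<open>z + 1\<close> adds to
    \<open>\<epsilon>\<^sub>z\<close> unless \<open>z\<close> occurs and \<open>z + 1\<close> does
    not. So either this cancellation takes place or \<open>z = a\<close> with no letter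
    \<open>a + 1\<close>; both mean \<open>z = c\<close>.\<close>
  have V_up: "z + 1 \<in> V \<or> z = c" if z: "z \<in> V" for z
  proof (cases "z = n")
    case True
    then show ?thesis using z top U_eq c by auto
  next
    case False
    then have "1 \<le> z" "z < n" using z UV(2) by auto
    have "(z \<in> U \<or> z = a) \<and> z + 1 \<notin> U" if "z + 1 \<notin> V"
      using mid[OF \<open>1 \<le> z\<close> \<open>z < n\<close>] z that U_gt[of z]
      by (cases "z = a"; cases "z \<in> U"; cases "z + 1 \<in> U") simp_all
    then show ?thesis
      using c(1) unfolding U_eq by (cases "z + 1 \<in> V") auto
  qed
  have V_le: "z \<le> c" if "z \<in> V" for z
  proof (rule ccontr)
    assume "\<not> z \<le> c"
    then have "z + k \<in> V" for k
      using that by (induction k) (use V_up in force)+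
    from this[of "n + 1"] show False using UV(2) by auto
  qed
  \<comment> \<open>Without bars \<open>d = c\<close> makes the interval \<open>{d+1..c}\<close>
    empty.\<close>
  define d where "d = (if V = {} then c else Min V - 1)"
  have V_eq: "V = {d+1..c}" and d: "d \<le> c"
  proof -
    have "V = {d+1..c} \<and> d \<le> c"
    proof (cases "V = {}")
      case False
      then have m: "Min V \<in> V" using fin by simp
      then have "1 \<le> Min V" "Min V \<le> c" using UV(2) V_le by auto
      moreover have "z \<in> V" if "Min V \<le> z" "z \<le> c" for z
        using that
      proof (induction rule: dec_induct)
        case base
        then show ?case using m by simp
      next
        case (step z)
        then show ?case using V_up[of z] by auto
      qed
      moreover have "V \<subseteq> {Min V..c}"
        using fin V_le by auto
      moreover have "d + 1 = Min V"
        using False \<open>1 \<le> Min V\<close> by (simp add: d_def)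
      ultimately show ?thesis by auto
    qed (simp add: d_def)
    then show "V = {d+1..c}" "d \<le> c" by simp_all
  qed
  have b_list: "b = map Unbarred [a+1..<c+1] @ map Barred (rev [d+1..<c+1])"
    unfolding b_eq using fin
    by (intro col_eqI)
      (auto simp: U_eq V_eq letters_def sorted_wrt_append sorted_wrt_map sorted_wrt_rev)
  have r: "r = (c - a) + (c - d)"
    using len by (simp add: b_list del: upt_Suc)
  \<comment> \<open>The letter \<open>c\<close> and its bar are neighbours, at positions
    \<open>c - a\<close> and \<open>c - a + 1\<close>. Admissibility at \<open>c\<close> thus
    requires \<open>1 > r - c\<close>, where \<open>r - c = c - d - a\<close> over the
    integers.\<close>
  have "c - d \<le> a"
  proof (rule ccontr)
    assume *: "\<not> c - d \<le> a"
    show False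
    proof (cases "c = a")
      case False
      with c(1) have "a < c" by simp
      then have "c - Suc a < c - a" by linarith
      then have "b ! (c - a - 1) = Unbarred c" "b ! (c - a + 1 - 1) = Barred c"
        using \<open>a < c\<close> * by (simp_all add: b_list nth_append rev_nth del: upt_Suc)
      moreover have "int (c - a + 1) - int (c - a) \<le> int r - int c"
        using * \<open>a < c\<close> r by linarith
      moreover have "c \<in> {1..n}" "c - a \<in> {1..r}" "c - a + 1 \<in> {1..r}"
        using \<open>a < c\<close> * r c(2) by auto
      ultimately show False
        using b unfolding KN_columns_def by blast
    qed (use * in simp)
  qed
  moreover have "phi (column_crystal n) i b = of_bool (i = d)" if i: "i \<le> n" for i
  proof -
    \<comment> \<open>This excludes the empty column, \<open>a = c = d\<close>, on which \<phi>
      would be 0.\<close>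
    have nonempty: "a < c \<or> d < c" using r assms(2) by auto
    consider "i = 0" | "i = n" "1 \<le> i" | "1 \<le> i" "i < n"
      using i by linarith
    then show ?thesis
    proof cases
      case 1
      have "1 \<in> V \<longleftrightarrow> d = 0" using nonempty by (auto simp: V_eq)
      then show ?thesis
        using column_zero(3)[OF good, of n] 1 by (simp add: V_def)
    next
      case 2
      then show ?thesis
        using column_top(2)[OF alph' assms(3)] nonempty c(2) d by (auto simp: b_eq U_eq V_eq)
    next
      case 3
      have "phi (column_crystal n) i b = (of_bool (i + 1 \<in> V) +
        (of_bool (i \<in> U) - of_bool (i + 1 \<in> U))) - of_bool (i \<in> V)"
        using column_mid(2)[of "letters U V" i n] 3 fin by (simp add: b_eq)
      also have "\<dots> = of_bool (i = d)"
        using nonempty 3 c d by (auto simp: U_eq V_eq)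
      finally show ?thesis .
    qed
  qed
  ultimately show ?thesis
    using c(1,2) d b_eq unfolding U_eq V_eq
    by (intro exI[of _ c] exI[of _ d] conjI allI impI)
qed

section \<open>The ground state condition and induction over the factors\<close>

lemma lookup_weight:
  "Poly_Mapping.lookup (\<Sum>j=0..n. Poly_Mapping.single j (f j)) i = (if i \<le> n then f i else 0)"
  for f :: "nat \<Rightarrow> int"
  by (simp add: lookup_sum lookup_single when_def)

lemma eps_wt_eq_Lam:
  "eps_wt n C x = Lam a \<Longrightarrow> i \<le> n \<Longrightarrow> eps C i x = of_bool (i = a)"
  using lookup_weight[of "\<lambda>j. int (eps C j x)" n i]
  by (auto simp: eps_wt_def Lam_def lookup_single when_def split: if_splits)

lemma eps_wt_eq_phi_wt:
  "eps_wt n C x = phi_wt n D y \<Longrightarrow> i \<le> n \<Longrightarrow> eps C i x = phi D i y"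
  using lookup_weight[of "\<lambda>j. int (eps C j x)" n i] lookup_weight[of "\<lambda>j. int (phi D j y)" n i]
  by (simp add: eps_wt_def phi_wt_def)

text \<open>Factors are numbered from the right, so removing the head, the leftmost factor, keeps
  the numbers of all others.\<close>

lemma ground_state_Cons:
  assumes "ground_state n (b # u)" and "u \<noteq> []"
  shows "ground_state n u"
    and "eps_wt n (column_crystal n) b = phi_wt n (column_crystal n) (hd u)"
proof -
  have factor: "factor (b # u) k = factor u k" if "1 \<le> k" "k \<le> length u" for k
    using that by (cases k) (simp_all add: factor_def nth_append)
  have step: "eps_wt n (column_crystal n) (factor (b # u) (k + 1)) =
      phi_wt n (column_crystal n) (factor (b # u) k)" if "1 \<le> k" "k \<le> length u" for k
    using assms(1) that by (simp add: ground_state_def)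
  have "1 \<le> length u" using assms(2) by (cases u) simp_all
  moreover have "factor (b # u) (length u + 1) = b" "factor (b # u) (length u) = hd u"
    using assms(2) \<open>1 \<le> length u\<close>
    by (simp_all add: factor_def nth_append rev_nth hd_conv_nth)
  ultimately show "eps_wt n (column_crystal n) b = phi_wt n (column_crystal n) (hd u)"
    using step[of "length u"] by simp
  have "eps_wt n (column_crystal n) (factor u (k + 1)) = phi_wt n (column_crystal n) (factor u k)"
    if "k \<in> {1..length u - 1}" for k
    using step[of k] factor[of k] factor[of "k + 1"] that by auto
  moreover have "eps_wt n (column_crystal n) (factor u 1) = Lam 0"
    using assms(1) factor[of 1] \<open>1 \<le> length u\<close> by (simp add: ground_state_def)
  ultimately show "ground_state n u"
    using assms(2) by (simp add: ground_state_def)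
qed

text \<open>Along the induction \<epsilon> of a new factor cancels against \<phi> of the product so
  far. Hence the product keeps \<epsilon> equal to \<open>\<Lambda>\<^sub>0\<close> and takes over
  \<phi> from its leftmost factor, which is what lifting the turns of the next factor
  requires.\<close>

lemma ground_state_turns:
  assumes "1 \<le> n" and "ground_state n u"
    and "\<forall>b\<in>set u. \<exists>r\<ge>1. b \<in> KN_columns n r"
  shows "\<exists>d\<le>n. (\<forall>i\<le>n. phi (column_crystal n) i (hd u) = of_bool (i = d)) \<and>
      (\<forall>i\<le>n. eps (KR_tensor_crystal n) i u = of_bool (i = 0)) \<and>
      (\<forall>i\<le>n. phi (KR_tensor_crystal n) i u = of_bool (i = d)) \<and>
      (\<exists>m z. full_strings (KR_tensor_crystal n) (\<lambda>i. lists (good_columns i))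
        (\<lambda>i. of_bool (i = 0)) (concat (replicate m (turn n))) u z \<and>
        (\<forall>b\<in>set z. \<exists>S\<subseteq>{1..n}. b = col (letters S {})))"
  using assms(2,3)
proof (induction u)
  case Nil
  then show ?case by (simp add: ground_state_def)
next
  case (Cons b u)
  let ?C = "column_crystal n" and ?T = "KR_tensor_crystal n"
  from Cons.prems(2) obtain r where r: "1 \<le> r" "b \<in> KN_columns n r" by auto
  have good: "b \<in> good_columns i" for i
    using KN_column_good[OF r(2) assms(1)] .
  have goods: "u \<in> lists (good_columns i)" for i
  proof -
    have "b \<in> good_columns i" if "b \<in> set u" for b
      using Cons.prems(2) that KN_column_good[OF _ assms(1)] by (meson list.set_intros(2))
    then show ?thesis by blast
  qed
  note T_Cons = normal_tensor_list_Cons[OF normal_column good goods]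
  show ?case
  proof (cases "u = []")
    case True
    then have "eps_wt n ?C b = Lam 0"
      using Cons.prems(1) by (simp add: ground_state_def factor_def)
    then have eps: "\<forall>i\<le>n. eps ?C i b = of_bool (i = 0)"
      by (intro allI impI eps_wt_eq_Lam)
    \<comment> \<open>For the rightmost factor \<open>a = 0\<close>, so \<open>c - d \<le> a\<close>
      leaves no bar and zero turns suffice.\<close>
    from ground_column[OF r(2,1) assms(1) le0 eps] obtain c d
      where cd: "d \<le> c" "c \<le> n" "c - d \<le> 0" "b = col (letters {0+1..c} {d+1..c})"
        and phi: "\<forall>i\<le>n. phi ?C i b = of_bool (i = d)"
      by (elim exE conjE)
    have "eps ?T i [] = 0" "phi ?T i [] = 0" for i
      using normal_tensor_list(2,3)[OF normal_column, of "[]"] by simp_all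
    then have "eps ?T i (b # u) = eps ?C i b" "phi ?T i (b # u) = phi ?C i b" for i
      using T_Cons[of n i] True by simp_all
    moreover have "d \<le> n" using cd by simp
    moreover have "full_strings ?T (\<lambda>i. lists (good_columns i)) (\<lambda>i. of_bool (i = 0))
        (concat (replicate 0 (turn n))) (b # u) [b]"
      using True by simp
    moreover have "\<exists>S\<subseteq>{1..n}. b = col (letters S {})"
      using cd by (intro exI[of _ "{1..c}"]) simp
    then have "\<forall>b\<in>set [b]. \<exists>S\<subseteq>{1..n}. b = col (letters S {})"
      by (simp only: list.set ball_simps simp_thms)
    ultimately show ?thesis
      using phi eps
      by (intro exI[of _ d] exI[of _ 0] exI[of _ "[b]"] conjI) (simp_all only: list.sel simp_thms)
  next
    case False
    note g = ground_state_Cons[OF Cons.prems(1) False]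
    have "\<forall>b\<in>set u. \<exists>r\<ge>1. b \<in> KN_columns n r"
      using Cons.prems(2) by simp
    from Cons.IH[OF g(1) this] obtain a m z where a: "a \<le> n"
      and phi_hd: "\<forall>i\<le>n. phi ?C i (hd u) = of_bool (i = a)"
      and eps_u: "\<forall>i\<le>n. eps ?T i u = of_bool (i = 0)"
      and phi_u: "\<forall>i\<le>n. phi ?T i u = of_bool (i = a)"
      and path: "full_strings ?T (\<lambda>i. lists (good_columns i)) (\<lambda>i. of_bool (i = 0))
        (concat (replicate m (turn n))) u z"
      and z: "\<forall>b\<in>set z. \<exists>S\<subseteq>{1..n}. b = col (letters S {})"
      by (elim exE conjE)
    have eps_b: "\<forall>i\<le>n. eps ?C i b = of_bool (i = a)"
      using eps_wt_eq_phi_wt[OF g(2)] phi_hd by simp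
    from ground_column[OF r(2,1) assms(1) a eps_b] obtain c d
      where cd: "a \<le> c" "d \<le> c" "c \<le> n" "c - d \<le> a" "b = col (letters {a+1..c} {d+1..c})"
        and phi_b: "\<forall>i\<le>n. phi ?C i b = of_bool (i = d)"
      by (elim exE conjE)
    have turns: "i \<le> n" if "i \<in> set (concat (replicate k (turn n)))" for i k
      using that set_turns[of k n] by auto
    \<comment> \<open>The left factor after \<open>h\<close> turns: its \<open>h\<close> lowest bars
      have become the letters \<open>1, \<dots>, h\<close>.\<close>
    define X where "X h = letters ({1..h} \<union> {a+1..c}) {d+h+1..c}" for h
    define b' where "b' = col (letters ({1..c-d} \<union> {a+1..c}) {})"
    have "full_strings ?C good_columns (\<lambda>i. of_bool (i = a)) (concat (replicate (c - d) (turn n)))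
        (col (X 0)) (col (X (c - d)))"
    proof (rule full_strings_power)
      fix h assume "h < c - d"
      then show "full_strings ?C good_columns (\<lambda>i. of_bool (i = a)) (turn n) (col (X h)) (col (X (Suc h)))"
        using turn_ground[of h a c n "d + h"] cd by (simp add: X_def)
    qed
    moreover have "col (X 0) = b" "col (X (c - d)) = b'"
      using cd by (simp_all add: X_def b'_def)
    ultimately have "full_strings ?C good_columns (\<lambda>i. of_bool (i = a))
        (concat (replicate (c - d) (turn n))) b b'" by simp
    then have 1: "full_strings ?T (\<lambda>i. lists (good_columns i)) (\<lambda>i. of_bool (i = 0))
        (concat (replicate (c - d) (turn n))) (b # u) (b' # u)"
      by (rule full_strings_Cons_left[rotated])
        (use goods normal_column eps_u phi_u turns in blast)+
    have "{1..c-d} \<union> {a+1..c} \<subseteq> {1..n}" using cd by auto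
    from turns_unbarred[where m = m, OF assms(1) this] obtain S where S: "S \<subseteq> {1..n}"
      "full_strings ?C good_columns (\<lambda>_. 0)
        (concat (replicate m (turn n))) b' (col (letters S {}))"
      unfolding b'_def by (elim exE conjE)
    \<comment> \<open>Whole turns keep \<epsilon> at 0 on the unbarred \<open>b'\<close> at the
      start of every string, so the turns clearing \<open>u\<close> lift.\<close>
    have 2: "full_strings ?T (\<lambda>i. lists (good_columns i)) (\<lambda>i. of_bool (i = 0))
        (concat (replicate m (turn n))) (b' # u) (col (letters S {}) # z)"
      by (intro full_strings_Cons normal_column S(2) path)
    have "full_strings ?T (\<lambda>i. lists (good_columns i)) (\<lambda>i. of_bool (i = 0))
        (concat (replicate (c - d + m) (turn n))) (b # u) (col (letters S {}) # z)"
      unfolding replicate_add concat_append full_strings_append using 1 2 by (intro exI conjI)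
    moreover have "\<forall>b\<in>set (col (letters S {}) # z). \<exists>S\<subseteq>{1..n}. b = col (letters S {})"
      using S(1) z by (simp only: list.set ball_simps) blast
    ultimately have path: "\<exists>m z. full_strings ?T (\<lambda>i. lists (good_columns i))
        (\<lambda>i. of_bool (i = 0)) (concat (replicate m (turn n))) (b # u) z \<and>
        (\<forall>b\<in>set z. \<exists>S\<subseteq>{1..n}. b = col (letters S {}))"
      by (intro exI conjI)
    show ?thesis
    proof (rule exI[of _ d], intro conjI allI impI)
      show "d \<le> n" using cd by simp
      show "phi ?C i (hd (b # u)) = of_bool (i = d)" if "i \<le> n" for i
        using phi_b that by simp
      show "eps ?T i (b # u) = of_bool (i = 0)" "phi ?T i (b # u) = of_bool (i = d)" if "i \<le> n" for i
        using that T_Cons[of n i] eps_u phi_u eps_b phi_b by simp_all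
    qed (rule path)
  qed
qed

theorem theorem5p2:
  fixes n N :: nat and r :: "nat \<Rightarrow> nat" and u :: "column list"
  assumes "N \<ge> 1"
    and "\<forall>k\<in>{1..N}. 1 \<le> r k \<and> r k \<le> n"
    and "u \<in> KR_tensor n N r"
    and "ground_state n u"
  shows "\<exists>(m :: nat) (i :: nat \<Rightarrow> nat) (x :: nat \<Rightarrow> column list).
           x 0 = u \<and>
           (\<forall>k\<in>{1..m}. i k \<in> {0..n} \<and>
              demazure_arrow (KR_tensor_crystal n) (i k) (x (k - 1)) (x k)) \<and>
           no_barred_letter (x m)"
proof -
  let ?T = "KR_tensor_crystal n"
  have n: "1 \<le> n" using assms(1,2) by (meson atLeastAtMost_iff order_refl order_trans)
  have "\<exists>r\<ge>1. b \<in> KN_columns n r" if "b \<in> set u" for b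
  proof -
    from that obtain k where k: "k < length u" "b = rev u ! k"
      by (metis in_set_conv_nth length_rev set_rev)
    with assms(3) have "factor u (Suc k) \<in> KN_columns n (r (Suc k))" "Suc k \<in> {1..N}"
      by (auto simp: KR_tensor_def)
    with assms(2) k show ?thesis by (auto simp: factor_def)
  qed
  then obtain m' z where path: "full_strings ?T (\<lambda>i. lists (good_columns i)) (\<lambda>i. of_bool (i = 0))
        (concat (replicate m' (turn n))) u z"
    and z: "\<forall>b\<in>set z. \<exists>S\<subseteq>{1..n}. b = col (letters S {})"
    using ground_state_turns[OF n assms(4)] by blast
  have "(demazure_step ?T n)\<^sup>*\<^sup>* u z"
    by (rule full_strings_demazure[OF normal_tensor_list(1)[OF normal_column] set_turns path])
  then obtain m x where x: "x 0 = u" "x m = z" "\<forall>k<m. demazure_step ?T n (x k) (x (Suc k))"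
    unfolding rtranclp_power relpowp_fun_conv by blast
  then obtain i where i: "\<forall>k<m. i k \<in> {0..n} \<and> demazure_arrow ?T (i k) (x k) (x (Suc k))"
    unfolding demazure_step_def by metis
  have "no_barred_letter z"
  proof -
    have "Barred y \<notin> set (col (letters S {}))" if "S \<subseteq> {1..n}" for S y
      using that finite_subset[OF that] by simp
    with z show ?thesis unfolding no_barred_letter_def by metis
  qed
  \<comment> \<open>The arrows obtained from the closure are numbered from 0, those of the theorem
    from 1.\<close>
  moreover have "i (k - 1) \<in> {0..n} \<and> demazure_arrow ?T (i (k - 1)) (x (k - 1)) (x k)"
    if "k \<in> {1..m}" for k
    using i[rule_format, of "k - 1"] that by auto
  ultimately show ?thesis
    using x by (intro exI[of _ m] exI[of _ "\<lambda>k. i (k - 1)"] exI[of _ x]) auto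
qed

end
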